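(* Every nonzero $\mathbf a\in\mathcal P^1_\omega$ has the strong anticupping property.
   Context: Let $\{\Phi_e\}_{e\in\mathbb N}$ be an effective enumeration of all partial computable functions $\Phi_e:\subseteq\mathbb N^{\mathbb N}\to\mathbb N^{\mathbb N}$. A learner is a total computable function $\Psi:\mathbb N^{<\mathbb N}\to\mathbb N$. For $A,B\subseteq\mathbb N^{\mathbb N}$, $A\le^1_\omega B$ means there are a partial function $\Gamma:\subseteq\mathbb N^{\mathbb N}\to\mathbb N^{\mathbb N}$ with $B\subseteq\mathrm{dom}(\Gamma)$ and $\Gamma(g)\in A$ for all $g\in B$, and a learner $\Psi$ such that for every $g\in\mathrm{dom}(\Gamma)$ the limit $\lim_n\Psi(g\upharpoonright n)$ exists and $\Phi_{\lim_n\Psi(g\upharpoonright n)}(g)=\Gamma(g)$. The $(1,\omega)$-degree of $A\subseteq\mathbb N^{\mathbb N}$ is its class under the equivalence induced by $\le^1_\omega$; degrees are ordered by $\le^1_\omega$ on representatives. $\mathcal P^1_\omega$ is the set of $(1,\omega)$-degrees of nonempty $\Pi^0_1$ subsets of $2^{\mathbb N}$. The zero degree is the least degree (the degree of the sets containing a computable element), and the join $\mathbf b\vee\mathbf c$ of the degrees of $B$ and $C$ is the degree of $B\otimes C=\{f\oplus g:f\in B,\ g\in C\}$, where $(f\oplus g)(2n)=f(n)$ and $(f\oplus g)(2n+1)=g(n)$. A degree $\mathbf a\in\mathcal P^1_\omega$ has the strong anticupping property if there is a nonzero degree $\mathbf b\in\mathcal P^1_\omega$ such that, for any $(1,\omega)$-degree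 $\mathbf c$ (of an arbitrary subset of $\mathbb N^{\mathbb N}$), if $\mathbf a\le\mathbf b\vee\mathbf c$, then $\mathbf a\le\mathbf c$. *)

theory Defs
  imports Complex_Main "HOL-Library.Nat_Bijection"
begin

type_synonym baire = "nat \<Rightarrow> nat"

section \<open>Partial computable functionals on Baire space\<close>

(* Programs denote partial functions on the natural numbers relative to a point g of Baire space,
   which Query reads. Several arguments are packed into one with the Cantor pairing
   prod_encode. *)

datatype prog =
    Zero
  | Succ
  | First
  | Second
  | Query
  | Pair prog prog
  | Comp prog prog
  | PrimRec prog prog
  | Search prog

primrec run :: "prog \<Rightarrow> baire \<Rightarrow> nat \<Rightarrow> nat option" where
  "run Zero g x = Some 0"
| "run Succ g x = Some (Suc x)"
| "run First g x = Some (fst (prod_decode x))"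
| "run Second g x = Some (snd (prod_decode x))"
| "run Query g x = Some (g x)"
| "run (Pair p q) g x =
     Option.bind (run p g x) (\<lambda>y. Option.bind (run q g x) (\<lambda>z. Some (prod_encode (y, z))))"
| "run (Comp p q) g x = Option.bind (run q g x) (run p g)"
| "run (PrimRec p q) g x =
     (case prod_decode x of (a, n) \<Rightarrow>
       rec_nat (run p g a)
         (\<lambda>k r. Option.bind r (\<lambda>y. run q g (prod_encode (a, prod_encode (k, y))))) n)"
| "run (Search p) g x =
     (if \<exists>n. run p g (prod_encode (x, n)) = Some 0 \<and>
             (\<forall>m<n. run p g (prod_encode (x, m)) \<noteq> None)
      then Some (LEAST n. run p g (prod_encode (x, n)) = Some 0)
      else None)"

primrec godel :: "prog \<Rightarrow> nat" where
  "godel Zero = 0"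
| "godel Succ = 1"
| "godel First = 2"
| "godel Second = 3"
| "godel Query = 4"
| "godel (Pair p q) = 5 + 4 * prod_encode (godel p, godel q)"
| "godel (Comp p q) = 6 + 4 * prod_encode (godel p, godel q)"
| "godel (PrimRec p q) = 7 + 4 * prod_encode (godel p, godel q)"
| "godel (Search p) = 8 + 4 * godel p"

lemma inj_godel: "inj godel"
proof (rule injI)
  show "p = q" if "godel p = godel q" for p q
    using that
  proof (induction p arbitrary: q)
    case Zero then show ?case by (cases q) simp_all
  next
    case Succ then show ?case by (cases q) simp_all
  next
    case First then show ?case by (cases q) simp_all
  next
    case Second then show ?case by (cases q) simp_all
  next
    case Query then show ?case by (cases q) simp_all
  next
    case (Pair p1 p2) then show ?case by (cases q) (simp_all, presburger+)
  next
    case (Comp p1 p2) then show ?case by (cases q) (simp_all, presburger+)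
  next
    case (PrimRec p1 p2) then show ?case by (cases q) (simp_all, presburger+)
  next
    case (Search p) then show ?case by (cases q) (simp_all, presburger+)
  qed
qed

lemma surj_godel: "surj godel"
proof -
  have "\<exists>p. godel p = n" for n
  proof (induction n rule: less_induct)
    case (less n)
    show ?case
    proof (cases "n < 5")
      case True
      then have "n = 0 \<or> n = 1 \<or> n = 2 \<or> n = 3 \<or> n = 4" by linarith
      then show ?thesis by (metis godel.simps(1-5))
    next
      case False
      define k where "k = (n - 5) div 4"
      obtain a b where ab: "k = prod_encode (a, b)"
        by (metis prod_decode_inverse surj_pair)
      have k: "k < n" using False by (auto simp: k_def)
      then have "a < n" "b < n"
        using le_prod_encode_1[of a b] le_prod_encode_2[of b a] ab by linarith+
      then obtain p q r where "godel p = a" "godel q = b" "godel r = k"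
        using less k by meson
      moreover have "n = 5 + 4 * k \<or> n = 6 + 4 * k \<or> n = 7 + 4 * k \<or> n = 8 + 4 * k"
        using False unfolding k_def by presburger
      ultimately show ?thesis
        using ab by (metis godel.simps(6-9))
    qed
  qed
  then show ?thesis by (metis surjI)
qed

lemma bij_godel: "bij godel"
  by (simp add: bij_def inj_godel surj_godel)

(* By bij_godel, every natural number is an index. *)
definition Phi :: "nat \<Rightarrow> baire \<rightharpoonup> baire" where
  "Phi e g =
     (if \<forall>n. run (inv godel e) g n \<noteq> None
      then Some (\<lambda>n. the (run (inv godel e) g n)) else None)"

primrec query_free :: "prog \<Rightarrow> bool" where
  "query_free Zero = True"
| "query_free Succ = True"
| "query_free First = True"
| "query_free Second = True"
| "query_free Query = False"
| "query_free (Pair p q) = (query_free p \<and> query_free q)"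
| "query_free (Comp p q) = (query_free p \<and> query_free q)"
| "query_free (PrimRec p q) = (query_free p \<and> query_free q)"
| "query_free (Search p) = query_free p"

definition computable :: "(nat \<Rightarrow> nat) \<Rightarrow> bool" where
  "computable f \<longleftrightarrow> (\<exists>p. query_free p \<and> (\<forall>g n. run p g n = Some (f n)))"

(* Finite strings are coded by the bijection list_encode. *)
definition computable_on_strings :: "(nat list \<Rightarrow> nat) \<Rightarrow> bool" where
  "computable_on_strings F \<longleftrightarrow> computable (\<lambda>k. F (list_decode k))"

definition initial_segment :: "baire \<Rightarrow> nat \<Rightarrow> nat list" (infixl "\<restriction>" 75) where
  "g \<restriction> n = map g [0..<n]"


section \<open>Reducibility by learners\<close>

(* Since nat carries the discrete topology, convergence means eventual constancy. *)
definition learn_le :: "baire set \<Rightarrow> baire set \<Rightarrow> bool" where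
  "learn_le A B \<longleftrightarrow>
     (\<exists>(\<Gamma> :: baire \<rightharpoonup> baire) (\<Psi> :: nat list \<Rightarrow> nat).
        computable_on_strings \<Psi> \<and>
        B \<subseteq> dom \<Gamma> \<and> (\<forall>g\<in>B. the (\<Gamma> g) \<in> A) \<and>
        (\<forall>g\<in>dom \<Gamma>. convergent (\<lambda>n. \<Psi> (g \<restriction> n)) \<and>
                    Phi (lim (\<lambda>n. \<Psi> (g \<restriction> n))) g = \<Gamma> g))"

definition learn_equiv :: "(baire set \<times> baire set) set" where
  "learn_equiv = {(A, B). learn_le A B \<and> learn_le B A}"

type_synonym degree = "baire set set"

definition deg :: "baire set \<Rightarrow> degree" where
  "deg A = learn_equiv `` {A}"

definition degrees :: "degree set" where
  "degrees = UNIV // learn_equiv"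

definition degree_le :: "degree \<Rightarrow> degree \<Rightarrow> bool" where
  "degree_le a b \<longleftrightarrow> (\<exists>A\<in>a. \<exists>B\<in>b. learn_le A B)"

definition baire_join :: "baire \<Rightarrow> baire \<Rightarrow> baire" where
  "baire_join f g = (\<lambda>n. if even n then f (n div 2) else g (n div 2))"

definition set_join :: "baire set \<Rightarrow> baire set \<Rightarrow> baire set" where
  "set_join B C = {baire_join f g | f g. f \<in> B \<and> g \<in> C}"

definition degree_join :: "degree \<Rightarrow> degree \<Rightarrow> degree" where
  "degree_join b c = (\<Union>B\<in>b. \<Union>C\<in>c. deg (set_join B C))"

definition zero_degree :: degree where
  "zero_degree = {A. \<exists>f\<in>A. computable f}"

(* Sanity checks on zero_degree follow: it is a degree, and it is the unique least one. *)

lemma convergent_lim_const: "convergent (\<lambda>n. c :: nat)" "lim (\<lambda>n. c :: nat) = c"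
  by (simp_all add: convergent_const)

lemma computable_const: "computable (\<lambda>_. c)"
proof -
  have "\<exists>p. query_free p \<and> (\<forall>g n. run p g n = Some c)"
  proof (induction c)
    case 0
    show ?case by (rule exI[of _ Zero]) simp
  next
    case (Suc c)
    then obtain p where "query_free p" "\<forall>g n. run p g n = Some c" by blast
    then show ?case by (intro exI[of _ "Comp Succ p"]) simp
  qed
  then show ?thesis by (simp add: computable_def)
qed

lemma learn_le_by_index:
  assumes "\<And>g. g \<in> B \<Longrightarrow> \<exists>f\<in>A. Phi e g = Some f"
  shows "learn_le A B"
  unfolding learn_le_def
proof (intro exI[of _ "Phi e |` B"] exI[of _ "\<lambda>_. e"] conjI ballI)
  show "computable_on_strings (\<lambda>_. e)"
    by (simp add: computable_on_strings_def computable_const)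
  show "B \<subseteq> dom (Phi e |` B)" using assms by fastforce
  show "the ((Phi e |` B) g) \<in> A" if "g \<in> B" for g using assms[OF that] that by auto
  show "convergent (\<lambda>n. e)" by (rule convergent_lim_const)
  show "Phi (lim (\<lambda>n. e)) g = (Phi e |` B) g" if "g \<in> dom (Phi e |` B)" for g
    using that by (auto simp: convergent_lim_const restrict_map_def split: if_splits)
qed

lemma Phi_godel: "(\<And>n. run p g n = Some (f n)) \<Longrightarrow> Phi (godel p) g = Some f"
  by (simp add: Phi_def inv_f_f[OF inj_godel])

lemma learn_le_refl: "learn_le A A"
  by (rule learn_le_by_index[where e = "godel Query"]) (metis Phi_godel run.simps(5))

lemma learn_le_if_computable: "f \<in> A \<Longrightarrow> computable f \<Longrightarrow> learn_le A B"
  unfolding computable_def by (metis Phi_godel learn_le_by_index)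

primrec fill :: "prog \<Rightarrow> prog \<Rightarrow> prog" where
  "fill r Zero = Zero"
| "fill r Succ = Succ"
| "fill r First = First"
| "fill r Second = Second"
| "fill r Query = r"
| "fill r (Pair p q) = Pair (fill r p) (fill r q)"
| "fill r (Comp p q) = Comp (fill r p) (fill r q)"
| "fill r (PrimRec p q) = PrimRec (fill r p) (fill r q)"
| "fill r (Search p) = Search (fill r p)"

lemma query_free_fill: "query_free r \<Longrightarrow> query_free (fill r p)"
  by (induction p) simp_all

lemma run_fill:
  assumes "\<And>n. run r g n = Some (f n)"
  shows "run (fill r p) g = run p f"
  by (induction p) (rule ext, simp add: assms)+

lemma computable_Phi:
  assumes "computable f" "Phi e f = Some h"
  shows "computable h"
proof -
  from assms(1) obtain r where r: "query_free r" "\<And>g n. run r g n = Some (f n)"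
    unfolding computable_def by blast
  have "run (inv godel e) f n = Some (h n)" for n
    using assms(2) by (auto simp: Phi_def split: if_splits)
  then show ?thesis
    unfolding computable_def using query_free_fill[OF r(1)] run_fill[OF r(2)] by metis
qed

lemma zero_degree_le:
  assumes "learn_le A B" "B \<in> zero_degree"
  shows "A \<in> zero_degree"
proof -
  from assms(2) obtain f where f: "f \<in> B" "computable f" by (auto simp: zero_degree_def)
  from assms(1) f(1) obtain e h where "Phi e f = Some h" "h \<in> A"
    unfolding learn_le_def by (metis domD option.sel subsetD)
  then show ?thesis using computable_Phi f(2) by (auto simp: zero_degree_def)
qed

lemma deg_eq_zero_degree: "A \<in> zero_degree \<Longrightarrow> deg A = zero_degree"
proof -
  assume A: "A \<in> zero_degree"
  have "B \<in> zero_degree" if "learn_le B A" for B using zero_degree_le that A by blast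
  moreover have "learn_le A B \<and> learn_le B A" if "B \<in> zero_degree" for B
    using A that learn_le_if_computable by (auto simp: zero_degree_def)
  ultimately show ?thesis by (auto simp: deg_def learn_equiv_def)
qed

lemma zero_degree_in_degrees: "zero_degree \<in> degrees"
proof -
  have "UNIV \<in> zero_degree" using computable_const by (auto simp: zero_degree_def)
  then show ?thesis
    using deg_eq_zero_degree[of UNIV] by (auto simp: degrees_def deg_def quotient_def)
qed

lemma least_degree_iff:
  assumes "a \<in> degrees"
  shows "(\<forall>b\<in>degrees. degree_le a b) \<longleftrightarrow> a = zero_degree"
proof
  assume "\<forall>b\<in>degrees. degree_le a b"
  then have "degree_le a zero_degree" using zero_degree_in_degrees by blast
  then obtain A where A: "A \<in> a" "A \<in> zero_degree"
    using zero_degree_le by (auto simp: degree_le_def)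
  from assms obtain C where C: "a = deg C" by (auto simp: degrees_def deg_def quotient_def)
  with A(1) have "learn_le C A" by (auto simp: deg_def learn_equiv_def)
  then show "a = zero_degree" using A(2) C zero_degree_le deg_eq_zero_degree by blast
next
  assume a: "a = zero_degree"
  show "\<forall>b\<in>degrees. degree_le a b"
  proof
    fix b assume "b \<in> degrees"
    then obtain B where "B \<in> b"
      using learn_le_refl by (auto simp: degrees_def quotient_def learn_equiv_def)
    moreover have "UNIV \<in> zero_degree" using computable_const by (auto simp: zero_degree_def)
    ultimately show "degree_le a b"
      using a computable_const learn_le_if_computable unfolding degree_le_def by blast
  qed
qed


section \<open>The strong anticupping property\<close>

definition cantor :: "baire set" where
  "cantor = {f. \<forall>n. f n \<in> {0, 1}}"

definition Pi01 :: "baire set \<Rightarrow> bool" where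
  "Pi01 P \<longleftrightarrow>
     (\<exists>R. computable_on_strings (\<lambda>s. of_bool (R s)) \<and> P = {f \<in> cantor. \<forall>n. R (f \<restriction> n)})"

definition P1w :: "degree set" where
  "P1w = deg ` {P. Pi01 P \<and> P \<noteq> {}}"

definition strong_anticupping :: "degree \<Rightarrow> bool" where
  "strong_anticupping a \<longleftrightarrow>
     (\<exists>b\<in>P1w. b \<noteq> zero_degree \<and>
        (\<forall>c\<in>degrees. degree_le a (degree_join b c) \<longrightarrow> degree_le a c))"

end

(*
  Let P be the set of paths through a tree, without computable elements. The points of Q are scripts
  that write bits on three tapes, where writing on tape i clears the tapes of larger number and all
  tapes have to stay in the tree of P. The tape of least number that is written infinitely often
  ends up holding an element of P, so Q has no computable element.

  Let a learner reduce P to the join of Q and C, and let h be in C. Given a legal script x with empty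
  tapes 1 and 2, let e be the guess of the learner at (x, h). Feed the output of e back to itself:
  extend x, without touching tape 1, until e computes from the script and h one more bit than tape 1
  holds, and write this bit on tape 1. Waiting is always possible by writing an element of P on
  tape 2, so unless the learner changes its guess this never gets stuck and tape 1 receives an
  element of P that h computes from x. A change of the guess, or a bit leading out of the tree,
  is a finite event; h then moves on to the next x. If every x failed, then by writing one more
  bit of a fixed element of P on tape 0 after each change of the guess we would obtain a point of Q
  on which the learner does not converge.
*)
theory Submission imports Defs "HOL-Library.Sublist"
begin

section \<open>Effective functions on encoded types\<close>

text \<open>The procedure sought reads only \<open>h\<close>; the script has to be manufactured, and
  the guess \<open>e\<close> followed may be wrong. Feeding the output of \<open>e\<close> back
  resolves both: every bit is tested against the tree before it is written, so the limit of a
  growing tape 1 is an element of P whether or not \<open>e\<close> is a limit of the learner.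
  Correctness of the learner serves only to exclude the ways of failing. Each tape has one task.
  Tape 0 records the diagonalisation; writing on it clears the others, so that the next candidate
  starts afresh. Tape 1 takes the output. Tape 2 fills the time until \<open>e\<close> answers:
  without it no script could be prolonged to a point of Q while tapes 0 and 1 are fixed. The chosen
  element of P is not computable, which is harmless because only the verification mentions it. The
  candidate changes finitely often, but no bound on the changes is known in advance; hence the
  result is a learner, whose limit depends on the number of the last candidate.\<close>

class encodable = fixes enc :: "'a \<Rightarrow> nat"

instantiation nat :: encodable begin
definition "enc = (\<lambda>n::nat. n)"
instance ..
end

instantiation bool :: encodable begin
definition "enc = (of_bool :: bool \<Rightarrow> nat)"
instance ..
end

instantiation prod :: (encodable, encodable) encodable begin
definition "enc = (\<lambda>(a :: 'a, b :: 'b). prod_encode (enc a, enc b))"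
instance ..
end

instantiation list :: (encodable) encodable begin
definition "enc = (\<lambda>xs :: 'a list. list_encode (map enc xs))"
instance ..
end

instantiation prog :: encodable begin
definition "enc = godel"
instance ..
end

lemma enc_simps [simp]:
  "enc n = n" "enc b = of_bool b" "enc (x, y) = prod_encode (enc x, enc y)"
  "enc [] = 0" "enc (z # zs) = Suc (prod_encode (enc z, enc zs))" "enc p = godel p"
  by (simp_all add: enc_nat_def enc_bool_def enc_prod_def enc_list_def enc_prog_def)

lemma enc_nat_list: "enc (xs :: nat list) = list_encode xs"
  by (simp add: enc_list_def enc_nat_def)

text \<open>Computability is transported along \<open>enc\<close>, so that proofs can follow the
  syntax of a definition: the rules collected in \<open>eff\<close> reduce each construct to its
  parts.\<close>

definition effective :: "('a :: encodable \<Rightarrow> 'b :: encodable) \<Rightarrow> bool" where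
  "effective f \<longleftrightarrow> (\<exists>F. computable F \<and> (\<forall>x. enc (f x) = F (enc x)))"

named_theorems eff

lemma computable_comp: "computable f \<Longrightarrow> computable g \<Longrightarrow> computable (\<lambda>x. f (g x))"
proof -
  assume "computable f" "computable g"
  then obtain p q where "query_free p" "\<forall>g n. run p g n = Some (f n)"
    "query_free q" "\<forall>h n. run q h n = Some (g n)"
    unfolding computable_def by blast
  then show ?thesis unfolding computable_def by (intro exI[of _ "Comp p q"]) simp
qed

lemma computable_pair:
  "computable f \<Longrightarrow> computable g \<Longrightarrow> computable (\<lambda>x. prod_encode (f x, g x))"
proof -
  assume "computable f" "computable g"
  then obtain p q where "query_free p" "\<forall>g n. run p g n = Some (f n)"
    "query_free q" "\<forall>h n. run q h n = Some (g n)"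
    unfolding computable_def by blast
  then show ?thesis unfolding computable_def by (intro exI[of _ "Pair p q"]) simp
qed

lemma computable_primitives:
  "computable (\<lambda>x. x)" "computable Suc"
  "computable (\<lambda>x. fst (prod_decode x))" "computable (\<lambda>x. snd (prod_decode x))"
  unfolding computable_def
  by (rule exI[of _ "Pair First Second"] exI[of _ Succ] exI[of _ First] exI[of _ Second]; simp)+

lemma computable_rec_nat:
  assumes "computable f" "computable g"
  shows "computable (\<lambda>x. rec_nat (f (fst (prod_decode x)))
    (\<lambda>k r. g (prod_encode (fst (prod_decode x), prod_encode (k, r)))) (snd (prod_decode x)))"
proof -
  from assms obtain p q where pq: "query_free p" "\<forall>g n. run p g n = Some (f n)"
    "query_free q" "\<forall>h n. run q h n = Some (g n)"
    unfolding computable_def by blast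
  have "rec_nat (run p h a) (\<lambda>k r. Option.bind r (\<lambda>y. run q h (prod_encode (a, prod_encode (k, y))))) n
     = Some (rec_nat (f a) (\<lambda>k r. g (prod_encode (a, prod_encode (k, r)))) n)" for h a n
    using pq by (induction n) simp_all
  then show ?thesis
    unfolding computable_def using pq
    by (intro exI[of _ "PrimRec p q"]) (simp add: case_prod_unfold)
qed

lemma effective_comp: "effective g \<Longrightarrow> effective f \<Longrightarrow> effective (\<lambda>x. g (f x))"
proof -
  assume "effective g" "effective f"
  then obtain G F where "computable G" "\<forall>x. enc (g x) = G (enc x)"
    "computable F" "\<forall>x. enc (f x) = F (enc x)"
    unfolding effective_def by blast
  then show ?thesis unfolding effective_def by (metis computable_comp)
qed

text \<open>Only codes matter: a map between types that leaves the code unchanged, such as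
  \<open>list_decode\<close> or \<open>prog_of\<close>, is effective for free.\<close>

lemma effective_cong_enc: "(\<And>x. enc (f x) = enc (g x)) \<Longrightarrow> effective g \<Longrightarrow> effective f"
  unfolding effective_def by metis

lemma effective_const [eff]: "effective (\<lambda>_. c)"
  unfolding effective_def using computable_const by blast

lemma effective_id [eff]: "effective (\<lambda>x. x)"
  unfolding effective_def using computable_primitives(1) by blast

lemma effective_Pair [eff]: "effective f \<Longrightarrow> effective g \<Longrightarrow> effective (\<lambda>x. (f x, g x))"
proof -
  assume "effective g" "effective f"
  then obtain G F where "computable G" "\<forall>x. enc (g x) = G (enc x)"
    "computable F" "\<forall>x. enc (f x) = F (enc x)"
    unfolding effective_def by blast
  then show ?thesis
    unfolding effective_def
    by (intro exI[of _ "\<lambda>x. prod_encode (F x, G x)"]) (simp add: computable_pair)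
qed

lemma effective_fst [eff]: "effective f \<Longrightarrow> effective (\<lambda>x. fst (f x))"
proof (rule effective_comp[of fst])
  show "effective (fst :: 'b \<times> 'c \<Rightarrow> 'b)"
    unfolding effective_def
    by (rule exI[of _ "\<lambda>x. fst (prod_decode x)"]) (auto simp: computable_primitives)
qed

lemma effective_snd [eff]: "effective f \<Longrightarrow> effective (\<lambda>x. snd (f x))"
proof (rule effective_comp[of snd])
  show "effective (snd :: 'b \<times> 'c \<Rightarrow> 'c)"
    unfolding effective_def
    by (rule exI[of _ "\<lambda>x. snd (prod_decode x)"]) (auto simp: computable_primitives)
qed

lemma effective_Suc [eff]: "effective f \<Longrightarrow> effective (\<lambda>x. Suc (f x))"
  by (rule effective_comp[of Suc])
     (use computable_primitives(2) in \<open>auto simp: effective_def\<close>)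

lemma effective_comp2:
  "effective (\<lambda>p. g (fst p) (snd p)) \<Longrightarrow> effective a \<Longrightarrow> effective b \<Longrightarrow> effective (\<lambda>x. g (a x) (b x))"
  using effective_comp[of "\<lambda>p. g (fst p) (snd p)" "\<lambda>x. (a x, b x)"] by (simp add: effective_Pair)

lemma effective_comp3:
  "effective (\<lambda>p. g (fst p) (fst (snd p)) (snd (snd p))) \<Longrightarrow> effective a \<Longrightarrow> effective b \<Longrightarrow>
    effective c \<Longrightarrow> effective (\<lambda>x. g (a x) (b x) (c x))"
  using effective_comp[of "\<lambda>p. g (fst p) (fst (snd p)) (snd (snd p))" "\<lambda>x. (a x, b x, c x)"]
  by (simp add: effective_Pair)

text \<open>\<open>PrimRec\<close> hands its parameter to every step. Taking the code of
  \<open>x\<close> itself as the parameter lets base and step depend on \<open>x\<close>. The later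
  iterations (\<open>funpow\<close>, \<open>foldl\<close>, bounded quantifiers) reduce to this
  rule.\<close>

lemma effective_rec_nat [eff]:
  assumes "effective a" "effective (\<lambda>p. g (fst p) (fst (snd p)) (snd (snd p)))" "effective n"
  shows "effective (\<lambda>x. rec_nat (a x) (\<lambda>k r. g x k r) (n x))"
proof -
  from assms obtain A G N
    where A: "computable A" "\<And>x. enc (a x) = A (enc x)"
      and G: "computable G" "\<And>p. enc (g (fst p) (fst (snd p)) (snd (snd p))) = G (enc p)"
      and N: "computable N" "\<And>x. n x = N (enc x)"
    unfolding effective_def by auto
  have G': "enc (g x k r) = G (prod_encode (enc x, prod_encode (k, enc r)))" for x k r
    using G(2)[of "(x, k, r)"] by simp
  define H where "H = (\<lambda>x. rec_nat (A (fst (prod_decode x)))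
    (\<lambda>k r. G (prod_encode (fst (prod_decode x), prod_encode (k, r)))) (snd (prod_decode x)))"
  have "enc (rec_nat (a x) (\<lambda>k r. g x k r) m) = H (prod_encode (enc x, m))" for x m
    by (induction m) (simp_all add: H_def A(2) G')
  moreover have "computable (\<lambda>x. H (prod_encode (x, N x)))"
    unfolding H_def
    using computable_comp[OF computable_rec_nat[OF A(1) G(1)]
        computable_pair[OF computable_primitives(1) N(1)]] .
  ultimately show ?thesis
    unfolding effective_def N(2) by blast
qed

lemma effective_case_nat [eff]:
  assumes "effective a" "effective (\<lambda>p. g (fst p) (snd p))" "effective n"
  shows "effective (\<lambda>x. case n x of 0 \<Rightarrow> a x | Suc k \<Rightarrow> g x k)"
proof -
  have "(\<lambda>x. case n x of 0 \<Rightarrow> a x | Suc k \<Rightarrow> g x k) = (\<lambda>x. rec_nat (a x) (\<lambda>k r. g x k) (n x))"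
    by (rule ext) (auto split: nat.splits)
  then show ?thesis
    using assms by (auto intro!: eff effective_comp2[OF assms(2)])
qed

lemma effective_of_bool [eff]: "effective P \<Longrightarrow> effective (\<lambda>x. of_bool (P x) :: nat)"
  by (rule effective_cong_enc[of _ P]) auto

lemma effective_if [eff]:
  assumes "effective P" "effective f" "effective g"
  shows "effective (\<lambda>x. if P x then f x else g x)"
proof -
  have "(\<lambda>x. if P x then f x else g x) = (\<lambda>x. case of_bool (P x) of 0 \<Rightarrow> g x | Suc k \<Rightarrow> f x)"
    by auto
  then show ?thesis
    by (auto intro!: eff assms effective_comp[OF assms(2)])
qed

lemma effective_Not [eff]: "effective P \<Longrightarrow> effective (\<lambda>x. \<not> P x)"
proof -
  assume "effective P"
  moreover have "(\<lambda>x. \<not> P x) = (\<lambda>x. if P x then False else True)" by auto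
  ultimately show ?thesis by (simp only: effective_if effective_const)
qed

lemma effective_conj [eff]: "effective P \<Longrightarrow> effective Q \<Longrightarrow> effective (\<lambda>x. P x \<and> Q x)"
proof -
  assume "effective P" "effective Q"
  moreover have "(\<lambda>x. P x \<and> Q x) = (\<lambda>x. if P x then Q x else False)" by auto
  ultimately show ?thesis by (simp only: effective_if effective_const)
qed

lemma effective_funpow [eff]:
  fixes F :: "'a :: encodable \<Rightarrow> 'b :: encodable \<Rightarrow> 'b"
  assumes "effective (\<lambda>p. F (fst p) (snd p))" "effective n" "effective a"
  shows "effective (\<lambda>x. (F x ^^ n x) (a x))"
proof -
  have "(F x ^^ m) y = rec_nat y (\<lambda>k r. F x r) m" for x m y
    by (induction m) simp_all
  then show ?thesis
    by (auto intro!: eff assms effective_comp2[OF assms(1)])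
qed

lemma effective_enc [eff]: "effective f \<Longrightarrow> effective (\<lambda>x. enc (f x))"
  by (rule effective_cong_enc[of _ f]) (simp_all only: enc_nat_def)

section \<open>Arithmetic and bounded quantifiers\<close>

lemma effective_add [eff]:
  fixes f g :: "'a :: encodable \<Rightarrow> nat"
  assumes "effective f" "effective g" shows "effective (\<lambda>x. f x + g x)"
proof -
  have "m + n = rec_nat m (\<lambda>k r. Suc r) n" for m n :: nat by (induction n) simp_all
  then show ?thesis by (auto intro!: eff assms)
qed

lemma effective_diff [eff]:
  fixes f g :: "'a :: encodable \<Rightarrow> nat"
  assumes "effective f" "effective g" shows "effective (\<lambda>x. f x - g x)"
proof -
  have "m - n = rec_nat m (\<lambda>k r. case r of 0 \<Rightarrow> 0 | Suc j \<Rightarrow> j) n" for m n :: nat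
    by (induction n) (auto simp: diff_Suc)
  then show ?thesis by (auto intro!: eff assms)
qed

lemma effective_eq_0: "effective (f :: _ \<Rightarrow> nat) \<Longrightarrow> effective (\<lambda>x. f x = 0)"
proof -
  assume f: "effective f"
  have "(\<lambda>x. f x = 0) = (\<lambda>x. case f x of 0 \<Rightarrow> True | Suc k \<Rightarrow> False)"
    by (rule ext) (simp split: nat.split)
  then show ?thesis by (auto intro!: eff f)
qed

lemma effective_le [eff]:
  fixes f g :: "'a :: encodable \<Rightarrow> nat"
  assumes "effective f" "effective g" shows "effective (\<lambda>x. f x \<le> g x)"
  using effective_eq_0[OF effective_diff[OF assms]] by simp

lemma effective_less [eff]:
  fixes f g :: "'a :: encodable \<Rightarrow> nat"
  assumes "effective f" "effective g" shows "effective (\<lambda>x. f x < g x)"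
  using effective_Not[OF effective_le[OF assms(2,1)]] by (simp add: not_le)

lemma effective_eq_nat [eff]:
  fixes f g :: "'a :: encodable \<Rightarrow> nat"
  assumes "effective f" "effective g" shows "effective (\<lambda>x. f x = g x)"
proof -
  have "(\<lambda>x. f x = g x) = (\<lambda>x. f x \<le> g x \<and> g x \<le> f x)" by auto
  then show ?thesis by (auto intro!: eff assms)
qed

lemma effective_divmod:
  fixes f :: "'a :: encodable \<Rightarrow> nat"
  assumes "effective f" "d > 0"
  shows "effective (\<lambda>x. (f x div d, f x mod d))"
proof -
  let ?F = "\<lambda>p. if Suc (snd p) = d then (Suc (fst p), 0) else (fst p, Suc (snd p))"
  have "(?F ^^ n) (0, 0) = (n div d, n mod d)" for n
    using assms(2) by (induction n) (auto simp: div_Suc mod_Suc)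
  then have "(\<lambda>x. (f x div d, f x mod d)) = (\<lambda>x. (?F ^^ f x) (0, 0))"
    by simp
  then show ?thesis
    by (simp only:) (intro eff assms(1))
qed

lemma effective_div [eff]: "effective f \<Longrightarrow> effective (\<lambda>x. f x div numeral d :: nat)"
  using effective_fst[OF effective_divmod[of f "numeral d"]] by simp

lemma effective_mod [eff]: "effective f \<Longrightarrow> effective (\<lambda>x. f x mod numeral d :: nat)"
  using effective_snd[OF effective_divmod[of f "numeral d"]] by simp

lemma effective_mult [eff]:
  fixes f g :: "'a :: encodable \<Rightarrow> nat"
  assumes "effective f" "effective g" shows "effective (\<lambda>x. f x * g x)"
proof -
  have "m * n = rec_nat 0 (\<lambda>k r. r + m) n" for m n :: nat by (induction n) simp_all
  then show ?thesis by (simp only:) (intro eff assms assms[THEN effective_comp])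
qed

lemma effective_even [eff]:
  fixes f :: "'a :: encodable \<Rightarrow> nat"
  assumes "effective f" shows "effective (\<lambda>x. even (f x))"
  unfolding even_iff_mod_2_eq_zero by (intro eff assms)

lemma effective_all_less [eff]:
  fixes P :: "'a :: encodable \<Rightarrow> nat \<Rightarrow> bool"
  assumes "effective (\<lambda>p. P (fst p) (snd p))" "effective n"
  shows "effective (\<lambda>x. \<forall>k<n x. P x k)"
proof -
  have "(\<forall>k<m. P x k) = rec_nat True (\<lambda>k r. r \<and> P x k) m" for x m
    by (induction m) (auto simp: less_Suc_eq)
  then show ?thesis
    by (auto intro!: eff assms effective_comp2[OF assms(1)])
qed

section \<open>Codes and lists\<close>

lemma effective_prod_encode [eff]: "effective f \<Longrightarrow> effective (\<lambda>x. prod_encode (f x))"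
  by (rule effective_cong_enc[of _ f]) (auto simp: split_paired_all enc_prod_def case_prod_unfold)

lemma effective_prod_decode [eff]: "effective f \<Longrightarrow> effective (\<lambda>x. prod_decode (f x))"
  by (rule effective_cong_enc[of _ f]) (auto simp: enc_prod_def case_prod_unfold)

lemma effective_list_decode [eff]: "effective f \<Longrightarrow> effective (\<lambda>x. list_decode (f x))"
  by (rule effective_cong_enc[of _ f]) (auto simp: enc_nat_list)

lemma effective_Cons [eff]:
  "effective f \<Longrightarrow> effective g \<Longrightarrow> effective (\<lambda>x. f x # g x)"
  by (rule effective_cong_enc[of _ "\<lambda>x. Suc (prod_encode (enc (f x), enc (g x)))"])
     (simp, intro eff)

lemma effective_case_list [eff]:
  assumes "effective a" "effective (\<lambda>p. g (fst p) (fst (snd p)) (snd (snd p)))" "effective n"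
  shows "effective (\<lambda>x. case n x of [] \<Rightarrow> a x | y # ys \<Rightarrow> g x y ys)"
proof -
  from assms(2) obtain G
    where G: "computable G" "\<And>p. enc (g (fst p) (fst (snd p)) (snd (snd p))) = G (enc p)"
    unfolding effective_def by auto
  have G': "enc (g x y ys) = G (prod_encode (enc x, prod_encode (enc y, enc ys)))" for x y ys
    using G(2)[of "(x, y, ys)"] by simp
  have "effective G" using G(1) by (auto simp: effective_def)
  have "effective (\<lambda>x. case enc (n x) of 0 \<Rightarrow> enc (a x) | Suc k \<Rightarrow> G (prod_encode (enc x, k)))"
    by (intro eff effective_comp[OF \<open>effective G\<close>] assms)
  moreover have "enc (case n x of [] \<Rightarrow> a x | y # ys \<Rightarrow> g x y ys)
      = enc (case enc (n x) of 0 \<Rightarrow> enc (a x) | Suc k \<Rightarrow> G (prod_encode (enc x, k)))" for x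
    by (cases "n x") (simp_all add: G')
  ultimately show ?thesis
    by (rule effective_cong_enc[rotated])
qed

lemma length_le_enc: "length xs \<le> enc xs"
proof (induction xs)
  case (Cons a xs)
  then show ?case using le_prod_encode_2[of "enc xs" "enc a"] by simp
qed simp

text \<open>The fold is an iteration on pairs of accumulator and remaining list. The code of the
  list serves as the number of rounds: it is at least the length, and rounds on an empty remainder
  change nothing.\<close>

lemma effective_foldl [eff]:
  assumes "effective (\<lambda>p. g (fst p) (fst (snd p)) (snd (snd p)))" "effective a" "effective xs"
  shows "effective (\<lambda>x. foldl (\<lambda>s y. g x s y) (a x) (xs x))"
proof -
  let ?G = "\<lambda>x p. case snd p of [] \<Rightarrow> p | y # ys \<Rightarrow> (g x (fst p) y, ys)"
  have *: "fst ((?G x ^^ n) (s, l)) = foldl (g x) s l" if "length l \<le> n" for x n s l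
    using that
  proof (induction n arbitrary: s l)
    case (Suc n)
    show ?case
    proof (cases l)
      case Nil
      have "(?G x ^^ m) (s, []) = (s, [])" for m by (induction m) simp_all
      then have "(?G x ^^ Suc n) (s, []) = (s, [])" .
      then show ?thesis using Nil by (simp only:) simp
    next
      case (Cons y ys)
      then have "(?G x ^^ Suc n) (s, l) = (?G x ^^ n) (g x s y, ys)"
        by (simp only: funpow_Suc_right o_apply) simp
      then show ?thesis using Suc.IH[of ys "g x s y"] Suc.prems Cons by (simp only:) simp
    qed
  qed simp
  have "foldl (g x) (a x) (xs x) = fst ((?G x ^^ enc (xs x)) (a x, xs x))" for x
    by (rule *[symmetric]) (rule length_le_enc)
  then show ?thesis
    by (simp only:) (intro eff effective_comp3[OF assms(1)] assms(2,3))
qed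

lemma effective_rev [eff]: "effective xs \<Longrightarrow> effective (\<lambda>x. rev (xs x))"
proof -
  assume xs: "effective xs"
  have "foldl (\<lambda>s y. y # s) s ys = rev ys @ s" for s ys :: "'b list"
    by (induction ys arbitrary: s) simp_all
  then have "(\<lambda>x. rev (xs x)) = (\<lambda>x. foldl (\<lambda>s y. y # s) [] (xs x))" by simp
  then show ?thesis by (simp only:) (intro eff xs)
qed

lemma effective_append [eff]:
  assumes "effective xs" "effective ys" shows "effective (\<lambda>x. xs x @ ys x)"
proof -
  have "foldl (\<lambda>s y. y # s) s ys = rev ys @ s" for s ys :: "'b list"
    by (induction ys arbitrary: s) simp_all
  then have "(\<lambda>x. xs x @ ys x) = (\<lambda>x. foldl (\<lambda>s y. y # s) (ys x) (rev (xs x)))" by simp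
  then show ?thesis by (simp only:) (intro eff assms)
qed

lemma effective_length [eff]: "effective xs \<Longrightarrow> effective (\<lambda>x. length (xs x))"
proof -
  assume xs: "effective xs"
  have "foldl (\<lambda>s y. Suc s) s ys = s + length ys" for s and ys :: "'b list"
    by (induction ys arbitrary: s) simp_all
  then have "(\<lambda>x. length (xs x)) = (\<lambda>x. foldl (\<lambda>s y. Suc s) 0 (xs x))" by simp
  then show ?thesis by (simp only:) (intro eff xs)
qed

lemma effective_map_upt [eff]:
  fixes g :: "'a :: encodable \<Rightarrow> nat \<Rightarrow> 'b :: encodable"
  assumes "effective (\<lambda>p. g (fst p) (snd p))" "effective n"
  shows "effective (\<lambda>x. map (g x) [0..<n x])"
proof -
  have "map (g x) [0..<m] = rec_nat [] (\<lambda>k r. r @ [g x k]) m" for x m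
    by (induction m) simp_all
  then show ?thesis by (simp only:) (intro eff effective_comp2[OF assms(1)] assms(2))
qed

lemma effective_initial_segment [eff]:
  fixes g :: "'a :: encodable \<Rightarrow> nat \<Rightarrow> nat"
  assumes "effective (\<lambda>p. g (fst p) (snd p))" "effective n"
  shows "effective (\<lambda>x. g x \<restriction> n x)"
  unfolding initial_segment_def by (intro effective_map_upt assms)

text \<open>Out of range \<open>nth\<close> is unspecified, so its effectivity could not be proved;
  the default 0 makes indexing a definite total function.\<close>

definition get :: "nat list \<Rightarrow> nat \<Rightarrow> nat" where
  "get xs i = (if i < length xs then xs ! i else 0)"

lemma effective_get [eff]:
  assumes "effective xs" "effective i" shows "effective (\<lambda>x. get (xs x) (i x))"
proof -
  have 1: "((\<lambda>l. case l of [] \<Rightarrow> [] | y # ys \<Rightarrow> ys) ^^ n) l = drop n l" for n and l :: "nat list"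
    by (induction n) (auto simp: drop_Suc tl_drop[symmetric] split: list.splits)
  have "get l n = (case drop n l of [] \<Rightarrow> 0 | y # ys \<Rightarrow> y)" for l n
    by (auto simp: get_def Cons_nth_drop_Suc[symmetric])
  then have "(\<lambda>x. get (xs x) (i x)) = (\<lambda>x. case ((\<lambda>l. case l of [] \<Rightarrow> [] | y # ys \<Rightarrow> ys) ^^ i x) (xs x)
      of [] \<Rightarrow> 0 | y # ys \<Rightarrow> y)"
    by (simp only: 1)
  then show ?thesis by (simp only:) (intro eff assms)
qed

lemma effective_min [eff]:
  fixes f g :: "'a :: encodable \<Rightarrow> nat"
  assumes "effective f" "effective g" shows "effective (\<lambda>x. min (f x) (g x))"
  unfolding min_def by (intro eff assms)

lemma take_eq_initial_segment: "take n xs = get xs \<restriction> min n (length xs)"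
  by (rule nth_equalityI) (auto simp: get_def initial_segment_def)

lemma effective_take [eff]:
  fixes xs :: "'a :: encodable \<Rightarrow> nat list"
  assumes "effective xs" "effective n" shows "effective (\<lambda>x. take (n x) (xs x))"
  unfolding take_eq_initial_segment by (intro eff effective_comp[OF assms(1)] assms)

lemma effective_eq_Nil [eff]:
  assumes "effective xs" shows "effective (\<lambda>x. xs x = [])"
proof -
  have "(\<lambda>x. xs x = []) = (\<lambda>x. length (xs x) = 0)" by auto
  then show ?thesis by (simp only:) (intro eff assms)
qed

lemma effective_eq_list [eff]:
  fixes xs ys :: "'a :: encodable \<Rightarrow> nat list"
  assumes "effective xs" "effective ys" shows "effective (\<lambda>x. xs x = ys x)"
proof -
  have "(\<lambda>x. xs x = ys x) = (\<lambda>x. enc (xs x) = enc (ys x))"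
    by (simp add: enc_nat_list list_encode_eq)
  then show ?thesis by (simp only:) (intro eff assms)
qed

text \<open>As \<open>list_decode\<close> is a bijection, the function on codes that witnesses
  effectivity is determined by \<open>F\<close>.\<close>

lemma computable_on_strings_iff: "computable_on_strings F \<longleftrightarrow> effective F"
proof
  assume "computable_on_strings F"
  then show "effective F"
    unfolding computable_on_strings_def effective_def
    by (intro exI[of _ "\<lambda>k. F (list_decode k)"]) (simp add: enc_nat_list)
next
  assume "effective F"
  then obtain G where G: "computable G" "\<And>xs. enc (F xs) = G (enc xs)"
    unfolding effective_def by blast
  have "G = (\<lambda>k. F (list_decode k))"
  proof
    show "G k = F (list_decode k)" for k
      using G(2)[of "list_decode k"] by (simp add: enc_nat_list)
  qed
  then show "computable_on_strings F"
    using G(1) by (simp add: computable_on_strings_def)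
qed

section \<open>Programs with access to the oracle\<close>

abbreviation prog_of :: "nat \<Rightarrow> prog" where "prog_of \<equiv> inv godel"

lemma godel_prog_of [simp]: "godel (prog_of e) = e"
  by (rule surj_f_inv_f[OF surj_godel])

lemma prog_of_godel [simp]: "prog_of (godel p) = p"
  by (rule inv_f_f[OF inj_godel])

lemma effective_prog_of [eff]: "effective f \<Longrightarrow> effective (\<lambda>x. prog_of (f x))"
  by (rule effective_cong_enc[of _ f]) simp_all

lemma effective_godel [eff]: "effective f \<Longrightarrow> effective (\<lambda>x. godel (f x))"
  by (rule effective_cong_enc[of _ f]) simp_all

lemma effective_prog [eff]:
  assumes "effective p" "effective q"
  shows "effective (\<lambda>x. Pair (p x) (q x))" "effective (\<lambda>x. Comp (p x) (q x))"
    "effective (\<lambda>x. PrimRec (p x) (q x))"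
  by (rule effective_cong_enc[of _ "\<lambda>x. 5 + 4 * prod_encode (enc (p x), enc (q x))"]
      effective_cong_enc[of _ "\<lambda>x. 6 + 4 * prod_encode (enc (p x), enc (q x))"]
      effective_cong_enc[of _ "\<lambda>x. 7 + 4 * prod_encode (enc (p x), enc (q x))"],
      simp, intro eff assms)+

text \<open>Codes of compound programs are 5, 6, 7 or 8 plus a multiple of 4. After subtraction of 5
  the residue modulo 4 names the constructor, and the quotient holds the arguments.\<close>

lemma effective_case_prog [eff]:
  assumes "effective z" "effective s" "effective f" "effective g" "effective h"
    and pair: "effective (\<lambda>p. a (fst p) (fst (snd p)) (snd (snd p)))"
    and comp: "effective (\<lambda>p. b (fst p) (fst (snd p)) (snd (snd p)))"
    and rec: "effective (\<lambda>p. c (fst p) (fst (snd p)) (snd (snd p)))"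
    and search: "effective (\<lambda>p. d (fst p) (snd p))"
    and p: "effective p"
  shows "effective (\<lambda>x. case p x of Zero \<Rightarrow> z x | Succ \<Rightarrow> s x | First \<Rightarrow> f x | Second \<Rightarrow> g x
    | Query \<Rightarrow> h x | Pair q r \<Rightarrow> a x q r | Comp q r \<Rightarrow> b x q r | PrimRec q r \<Rightarrow> c x q r
    | Search q \<Rightarrow> d x q)"
proof -
  define k where "k n = (n - 5) div 4" for n :: nat
  define l where "l n = prog_of (fst (prod_decode (k n)))" for n
  define r where "r n = prog_of (snd (prod_decode (k n)))" for n
  define u where "u n = prog_of (k (n - 3))" for n
  have inner: "effective (\<lambda>x. l (godel (p x)))" "effective (\<lambda>x. r (godel (p x)))"
      "effective (\<lambda>x. u (godel (p x)))"
    unfolding l_def r_def u_def k_def by (intro eff p)+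
  have m: "(4 * n) mod 4 = 0" "Suc (4 * n) mod 4 = 1" "Suc (Suc (4 * n)) mod 4 = 2"
    "(3 + 4 * n) mod 4 = 3" "4 * n div 4 = n" "(Suc (4 * n)) div 4 = n"
    "(Suc (Suc (4 * n))) div 4 = n" for n :: nat
    by presburger+
  have "(case q of Zero \<Rightarrow> z x | Succ \<Rightarrow> s x | First \<Rightarrow> f x | Second \<Rightarrow> g x
    | Query \<Rightarrow> h x | Pair q r \<Rightarrow> a x q r | Comp q r \<Rightarrow> b x q r | PrimRec q r \<Rightarrow> c x q r
    | Search q \<Rightarrow> d x q) =
    (if godel q = 0 then z x else if godel q = 1 then s x else if godel q = 2 then f x
     else if godel q = 3 then g x else if godel q = 4 then h x
     else if (godel q - 5) mod 4 = 0 then a x (l (godel q)) (r (godel q))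
     else if (godel q - 5) mod 4 = 1 then b x (l (godel q)) (r (godel q))
     else if (godel q - 5) mod 4 = 2 then c x (l (godel q)) (r (godel q))
     else d x (u (godel q)))" for q x
    by (cases q) (simp_all add: l_def r_def u_def k_def m)
  then show ?thesis
    by (simp only:)
      (intro eff assms(1-5) effective_comp3[OF pair] effective_comp3[OF comp]
        effective_comp3[OF rec] effective_comp2[OF search] inner p effective_id)
qed

section \<open>Search through growing initial segments of the oracle\<close>

lemma oracle_program:
  fixes G :: "nat list \<times> nat \<Rightarrow> nat"
  assumes "effective G"
  obtains p where "\<And>h x s. run p h (prod_encode (x, s)) = Some (G (h \<restriction> s, x))"
proof -
  have "effective (\<lambda>p. G (rev (fst p), snd p))"
    by (intro eff effective_comp[OF assms])
  then obtain F where "computable F" and F: "\<And>p. G (rev (fst p), snd p) = F (enc p)"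
    unfolding effective_def by auto
  then obtain pF where pF: "\<And>h n. run pF h n = Some (F n)"
    unfolding computable_def by blast
  \<comment> \<open>Primitive recursion can prepend the newest answer but not append it, so the
    answers arrive in reverse order; \<open>F\<close> was chosen to undo this.\<close>
  define S where "S = PrimRec Zero
    (Comp Succ (Pair (Comp Query (Comp First Second)) (Comp Second Second)))"
  have S: "run S h (prod_encode (x, s)) = Some (list_encode (rev (h \<restriction> s)))" for h x s
    unfolding S_def by (induction s) (simp_all add: initial_segment_def)
  have "run (Comp pF (Pair S First)) h (prod_encode (x, s)) = Some (G (h \<restriction> s, x))" for h x s
    using F[of "(rev (h \<restriction> s), x)"] by (simp add: S pF enc_nat_list)
  then show ?thesis by (rule that)
qed

text \<open>Unbounded search combined with the s-m-n theorem: \<open>c\<close> is hard-wired into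
  the program, so the index depends on it effectively. \<open>G\<close> codes "no answer yet" as 0
  and the answer \<open>n\<close> as \<open>Suc n\<close>.\<close>

lemma search_index:
  fixes G :: "nat list \<times> nat \<times> nat \<Rightarrow> nat"
  assumes "effective G"
  obtains ix where "effective ix"
    and "\<And>c h. (\<And>k. \<exists>s. G (h \<restriction> s, c, k) \<noteq> 0) \<Longrightarrow>
      Phi (ix c) h = Some (\<lambda>k. G (h \<restriction> (LEAST s. G (h \<restriction> s, c, k) \<noteq> 0), c, k) - 1)"
proof -
  \<comment> \<open>\<open>Search\<close> looks for the value 0, so \<open>t\<close> is made 0
    exactly where \<open>G\<close> has an answer. Since \<open>t\<close> is total, a search that has
    a solution is defined.\<close>
  have "effective (\<lambda>p. if G (fst p, prod_decode (snd p)) = 0 then 1 else 0 :: nat)"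
    by (intro eff effective_comp[OF assms])
  from oracle_program[OF this] obtain t where t:
    "\<And>h x s. run t h (prod_encode (x, s)) = Some (if G (h \<restriction> s, prod_decode x) = 0 then 1 else 0)"
    by auto
  have "effective (\<lambda>p. G (fst p, prod_decode (snd p)) - 1)"
    by (intro eff effective_comp[OF assms])
  from oracle_program[OF this] obtain v where v:
    "\<And>h x s. run v h (prod_encode (x, s)) = Some (G (h \<restriction> s, prod_decode x) - 1)"
    by auto
  define M where "M = Comp v (Pair (Pair First Second) (Search t))"
  define K where "K c = (Comp Succ ^^ c) Zero" for c :: nat
  have K: "run (K c) g x = Some c" for c g x
    by (induction c) (simp_all add: K_def)
  define ix where "ix c = godel (Comp M (Pair (K c) (Pair First Second)))" for c
  have "effective ix"
    unfolding ix_def[abs_def] K_def by (intro eff)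
  moreover have "Phi (ix c) h = Some (\<lambda>k. G (h \<restriction> (LEAST s. G (h \<restriction> s, c, k) \<noteq> 0), c, k) - 1)"
    if ex: "\<And>k. \<exists>s. G (h \<restriction> s, c, k) \<noteq> 0" for c h
    unfolding ix_def
  proof (rule Phi_godel)
    fix k
    have "run t h (prod_encode (prod_encode (c, k), n)) = Some 0 \<longleftrightarrow> G (h \<restriction> n, c, k) \<noteq> 0" for n
      by (simp add: t)
    then show "run (Comp M (Pair (K c) (Pair First Second))) h k
        = Some (G (h \<restriction> (LEAST s. G (h \<restriction> s, c, k) \<noteq> 0), c, k) - 1)"
      using ex[of k] by (simp add: M_def K v t)
  qed
  ultimately show ?thesis by (rule that)
qed


section \<open>A step-bounded universal evaluator\<close>

text \<open>A configuration is a stack of frames and a current value. A frame with tag 0 applies its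
  program to the current value; tags 1 and 2 continue a \<open>Pair\<close>, tag 3 a \<open>PrimRec\<close> and tag 4 a
  \<open>Search\<close>, the third component being the saved context. A query beyond the finite oracle blocks
  the machine for ever.\<close>

type_synonym config = "(nat \<times> prog \<times> nat) list \<times> nat"

definition mstep :: "nat list \<Rightarrow> config \<Rightarrow> config" where
  "mstep \<sigma> C = (case fst C of [] \<Rightarrow> C | F # K \<Rightarrow>
    if fst F = 0 then (case fst (snd F) of
        Zero \<Rightarrow> (K, 0)
      | Succ \<Rightarrow> (K, Suc (snd C))
      | First \<Rightarrow> (K, fst (prod_decode (snd C)))
      | Second \<Rightarrow> (K, snd (prod_decode (snd C)))
      | Query \<Rightarrow> if snd C < length \<sigma> then (K, get \<sigma> (snd C)) else C
      | Pair p q \<Rightarrow> ((0, p, 0) # (1, q, snd C) # K, snd C)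
      | Comp p q \<Rightarrow> ((0, q, 0) # (0, p, 0) # K, snd C)
      | PrimRec p q \<Rightarrow> (case snd (prod_decode (snd C)) of
          0 \<Rightarrow> ((0, p, 0) # K, fst (prod_decode (snd C)))
        | Suc k \<Rightarrow> ((0, PrimRec p q, 0) # (3, q, prod_encode (fst (prod_decode (snd C)), k)) # K,
                    prod_encode (fst (prod_decode (snd C)), k)))
      | Search p \<Rightarrow> ((0, p, 0) # (4, p, prod_encode (snd C, 0)) # K, prod_encode (snd C, 0)))
    else if fst F = 1 then ((0, fst (snd F), 0) # (2, fst (snd F), snd C) # K, snd (snd F))
    else if fst F = 2 then (K, prod_encode (snd (snd F), snd C))
    else if fst F = 3 then ((0, fst (snd F), 0) # K,
      prod_encode (fst (prod_decode (snd (snd F))), prod_encode (snd (prod_decode (snd (snd F))), snd C)))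
    else if snd C = 0 then (K, snd (prod_decode (snd (snd F))))
    else (let c = snd (snd F); d = prod_encode (fst (prod_decode c), Suc (snd (prod_decode c)))
      in ((0, fst (snd F), 0) # (4, fst (snd F), d) # K, d)))"

lemma effective_mstep: "effective (\<lambda>p. mstep (fst p) (snd p))"
  unfolding mstep_def Let_def by (intro eff)

text \<open>One number of steps and one oracle length have to serve all longer oracles. This
  uniformity makes the relation transitive and allows two computations to be compared on a common
  oracle.\<close>

definition runs :: "baire \<Rightarrow> config \<Rightarrow> config \<Rightarrow> bool" where
  "runs F C D \<longleftrightarrow> (\<exists>n N. \<forall>m\<ge>N. (mstep (F \<restriction> m) ^^ n) C = D)"

lemma runs_trans [trans]: "runs F C D \<Longrightarrow> runs F D E \<Longrightarrow> runs F C E"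
proof -
  assume "runs F C D" "runs F D E"
  then obtain n N n' N' where "\<forall>m\<ge>N. (mstep (F \<restriction> m) ^^ n) C = D"
    "\<forall>m\<ge>N'. (mstep (F \<restriction> m) ^^ n') D = E"
    unfolding runs_def by blast
  then have "\<forall>m\<ge>max N N'. (mstep (F \<restriction> m) ^^ (n' + n)) C = E"
    by (simp add: funpow_add)
  then show ?thesis unfolding runs_def by blast
qed

lemma runs_step: "(\<And>m. m \<ge> N \<Longrightarrow> mstep (F \<restriction> m) C = D) \<Longrightarrow> runs F C D"
  unfolding runs_def by (intro exI[of _ 1] exI[of _ N]) simp

lemma runs_stepI: "(\<And>m. mstep (F \<restriction> m) C = D) \<Longrightarrow> runs F D E \<Longrightarrow> runs F C E"
  using runs_step runs_trans by blast

lemma length_initial_segment [simp]: "length (g \<restriction> n) = n"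
  by (simp add: initial_segment_def)

lemma get_initial_segment [simp]: "i < n \<Longrightarrow> get (g \<restriction> n) i = g i"
  by (simp add: get_def initial_segment_def)

text \<open>Only converging computations are simulated. This suffices: every later claim about a
  value of the evaluator assumes convergence, and the converse then follows from
  determinism.\<close>

lemma runs_if_run: "run p F x = Some y \<Longrightarrow> runs F ((0, p, c) # K, x) (K, y)"
proof (induction p arbitrary: x y c K)
  case Query
  then show ?case by (intro runs_step[of "Suc x"]) (auto simp: mstep_def)
next
  case (Pair p q)
  then obtain u v where uv: "run p F x = Some u" "run q F x = Some v" "y = prod_encode (u, v)"
    by (auto split: bind_splits)
  have "runs F ((0, Pair p q, c) # K, x) ((0, p, 0) # (1, q, x) # K, x)"
    by (rule runs_step) (simp add: mstep_def)
  also have "runs F \<dots> ((1, q, x) # K, u)" by (rule Pair.IH uv)+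
  also have "runs F \<dots> ((0, q, 0) # (2, q, u) # K, x)"
    by (rule runs_step) (simp add: mstep_def)
  also have "runs F \<dots> ((2, q, u) # K, v)" by (rule Pair.IH uv)+
  also have "runs F \<dots> (K, y)"
    by (rule runs_step) (simp add: mstep_def uv)
  finally show ?case .
next
  case (Comp p q)
  then obtain u where u: "run q F x = Some u" "run p F u = Some y"
    by (auto split: bind_splits)
  have "runs F ((0, Comp p q, c) # K, x) ((0, q, 0) # (0, p, 0) # K, x)"
    by (rule runs_step) (simp add: mstep_def)
  also have "runs F \<dots> ((0, p, 0) # K, u)" by (rule Comp.IH u)+
  also have "runs F \<dots> (K, y)" by (rule Comp.IH u)+
  finally show ?case .
next
  case (PrimRec p q)
  obtain a n where an: "x = prod_encode (a, n)" by (metis prod_decode_inverse surj_pair)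
  have "runs F ((0, PrimRec p q, c) # K, prod_encode (a, n)) (K, y)"
    if "run (PrimRec p q) F (prod_encode (a, n)) = Some y" for n y c K
    using that
  proof (induction n arbitrary: y c K)
    case 0
    have "runs F ((0, PrimRec p q, c) # K, prod_encode (a, 0)) ((0, p, 0) # K, a)"
      by (rule runs_step) (simp add: mstep_def)
    also have "runs F \<dots> (K, y)" using 0 by (intro PrimRec.IH) simp
    finally show ?case .
  next
    case (Suc n)
    then obtain u where u: "run (PrimRec p q) F (prod_encode (a, n)) = Some u"
      "run q F (prod_encode (a, prod_encode (n, u))) = Some y"
      by (auto split: bind_splits)
    have "runs F ((0, PrimRec p q, c) # K, prod_encode (a, Suc n))
        ((0, PrimRec p q, 0) # (3, q, prod_encode (a, n)) # K, prod_encode (a, n))"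
      by (rule runs_step) (simp add: mstep_def)
    also have "runs F \<dots> ((3, q, prod_encode (a, n)) # K, u)" by (rule Suc.IH u)+
    also have "runs F \<dots> ((0, q, 0) # K, prod_encode (a, prod_encode (n, u)))"
      by (rule runs_step) (simp add: mstep_def)
    also have "runs F \<dots> (K, y)" by (rule PrimRec.IH u)+
    finally show ?case .
  qed
  then show ?case using PrimRec.prems an by simp
next
  case (Search p)
  let ?Z = "\<lambda>n. run p F (prod_encode (x, n)) = Some 0"
  from Search.prems obtain n0 where n0: "?Z n0" "\<forall>m<n0. run p F (prod_encode (x, m)) \<noteq> None"
    and y: "y = (LEAST n. ?Z n)"
    by (auto split: if_splits)
  have Zy: "?Z y" unfolding y by (rule LeastI[of ?Z, OF n0(1)])
  have "y \<le> n0" unfolding y by (rule Least_le[of ?Z, OF n0(1)])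
  then have nz: "\<exists>v. run p F (prod_encode (x, m)) = Some (Suc v)" if "m < y" for m
    using n0(2) that not_less_Least[of m ?Z] y
    by (metis not_None_eq not0_implies_Suc order_less_le_trans)
  \<comment> \<open>The search is followed backwards from its last test; \<open>d\<close> is the
    distance from the result \<open>y\<close>.\<close>
  have "runs F ((0, p, 0) # (4, p, prod_encode (x, y - d)) # K, prod_encode (x, y - d)) (K, y)"
    if "d \<le> y" for d
    using that
  proof (induction d)
    case 0
    have "runs F ((0, p, 0) # (4, p, prod_encode (x, y)) # K, prod_encode (x, y))
        ((4, p, prod_encode (x, y)) # K, 0)"
      by (rule Search.IH Zy)+
    also have "runs F \<dots> (K, y)" by (rule runs_step) (simp add: mstep_def)
    finally show ?case by simp
  next
    case (Suc d)
    let ?m = "y - Suc d"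
    have m: "Suc ?m = y - d" using Suc.prems by simp
    obtain v where v: "run p F (prod_encode (x, ?m)) = Some (Suc v)"
      using nz[of ?m] Suc.prems by auto
    have "runs F ((0, p, 0) # (4, p, prod_encode (x, ?m)) # K, prod_encode (x, ?m))
        ((4, p, prod_encode (x, ?m)) # K, Suc v)"
      by (rule Search.IH v)+
    also have "runs F \<dots> ((0, p, 0) # (4, p, prod_encode (x, y - d)) # K, prod_encode (x, y - d))"
      by (rule runs_step) (simp add: mstep_def m Let_def)
    also have "runs F \<dots> (K, y)" using Suc by simp
    finally show ?case .
  qed
  from this[of y] have "runs F ((0, p, 0) # (4, p, prod_encode (x, 0)) # K, prod_encode (x, 0)) (K, y)"
    by simp
  then show ?case
    by (rule runs_stepI[rotated]) (simp add: mstep_def)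
qed (auto intro!: runs_step simp: mstep_def)

definition eval_bounded :: "nat \<Rightarrow> nat list \<Rightarrow> nat \<Rightarrow> nat \<Rightarrow> nat" where
  "eval_bounded s \<sigma> e x = (let C = (mstep \<sigma> ^^ s) ([(0, prog_of e, 0)], x)
    in if fst C = [] then Suc (snd C) else 0)"

lemma effective_eval_bounded [eff]:
  assumes "effective s" "effective \<sigma>" "effective e" "effective x"
  shows "effective (\<lambda>z. eval_bounded (s z) (\<sigma> z) (e z) (x z))"
  unfolding eval_bounded_def Let_def
  by (intro eff assms effective_comp2[OF effective_mstep] effective_comp[OF assms(2)])

lemma mstep_halted: "(mstep \<sigma> ^^ n) ([], y) = ([], y)"
  by (induction n) (simp_all add: mstep_def)

text \<open>A longer oracle matters only where the machine is blocked on a query, and a blocked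
  machine does not move.\<close>

lemma mstep_oracle_mono:
  assumes "\<And>i. i < length \<sigma> \<Longrightarrow> i < length \<tau> \<and> get \<tau> i = get \<sigma> i"
  shows "mstep \<sigma> C = C \<or> mstep \<tau> C = mstep \<sigma> C"
proof (cases "fst C")
  case (Cons F K)
  then show ?thesis
    using assms[of "snd C"] by (cases "fst (snd F)") (auto simp: mstep_def)
qed (simp add: mstep_def)

lemma funpow_mstep_oracle_mono:
  assumes mono: "\<And>i. i < length \<sigma> \<Longrightarrow> i < length \<tau> \<and> get \<tau> i = get \<sigma> i"
    and "(mstep \<sigma> ^^ n) C = ([], y)"
  shows "(mstep \<tau> ^^ n) C = ([], y)"
  using assms(2)
proof (induction n arbitrary: C)
  case (Suc n)
  show ?case
  proof (cases "mstep \<sigma> C = C")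
    case True
    \<comment> \<open>A machine that does not move now never will, so \<open>C\<close> is already
      the halted configuration.\<close>
    then have "(mstep \<sigma> ^^ m) C = C" for m by (induction m) simp_all
    then show ?thesis using Suc.prems mstep_halted by metis
  next
    case False
    then have "mstep \<tau> C = mstep \<sigma> C" using mstep_oracle_mono[OF mono] by blast
    moreover have "(mstep \<sigma> ^^ n) (mstep \<sigma> C) = ([], y)"
      using Suc.prems by (simp only: funpow_Suc_right o_apply)
    ultimately show ?thesis
      using Suc.IH by (simp only: funpow_Suc_right o_apply)
  qed
qed simp

text \<open>The bounded computation and the one given by \<open>run\<close> are compared on a common
  longer oracle after \<open>n + s\<close> steps. Both have halted by then, so their values
  agree.\<close>

lemma eval_bounded_unique:
  assumes run: "run (prog_of e) F x = Some y" and pos: "eval_bounded s (F \<restriction> m) e x \<noteq> 0"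
  shows "eval_bounded s (F \<restriction> m) e x = Suc y"
proof -
  let ?C = "([(0, prog_of e, 0)], x)"
  from pos obtain z where z: "(mstep (F \<restriction> m) ^^ s) ?C = ([], z)"
    by (cases "(mstep (F \<restriction> m) ^^ s) ?C") (auto simp: eval_bounded_def split: if_splits)
  from runs_if_run[OF run] obtain n N where n: "\<forall>m\<ge>N. (mstep (F \<restriction> m) ^^ n) ?C = ([], y)"
    unfolding runs_def by blast
  let ?M = "mstep (F \<restriction> max m N)"
  have s: "(?M ^^ s) ?C = ([], z)"
    by (rule funpow_mstep_oracle_mono[OF _ z]) simp
  have "(?M ^^ (n + s)) ?C = ([], z)" using s by (simp add: funpow_add mstep_halted)
  moreover have "(?M ^^ (s + n)) ?C = ([], y)" using n by (simp add: funpow_add mstep_halted)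
  ultimately have "y = z" by (simp add: add.commute)
  then show ?thesis using z by (simp add: eval_bounded_def)
qed

lemma eval_bounded_complete:
  assumes run: "run (prog_of e) F x = Some y"
  shows "\<exists>N. \<forall>s\<ge>N. \<forall>m\<ge>N. eval_bounded s (F \<restriction> m) e x = Suc y"
proof -
  let ?C = "([(0, prog_of e, 0)], x)"
  from runs_if_run[OF run] obtain n N where n: "\<forall>m\<ge>N. (mstep (F \<restriction> m) ^^ n) ?C = ([], y)"
    unfolding runs_def by blast
  have "eval_bounded s (F \<restriction> m) e x = Suc y" if "s \<ge> max n N" "m \<ge> max n N" for s m
  proof -
    have "(mstep (F \<restriction> m) ^^ ((s - n) + n)) ?C = ([], y)"
      using n that unfolding funpow_add by (simp add: mstep_halted)
    then show ?thesis using that by (simp add: eval_bounded_def)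
  qed
  then show ?thesis by blast
qed

section \<open>Learner reducibility\<close>

lemma Phi_eq_Some_iff: "Phi e F = Some p \<longleftrightarrow> (\<forall>n. run (prog_of e) F n = Some (p n))"
  by (auto simp: Phi_def fun_eq_iff) (metis option.sel, metis option.distinct(1))

text \<open>The learner determines the values of \<Gamma>, so \<Gamma> may be cut down to
  \<open>B\<close>, which removes every demand on the learner outside \<open>B\<close>.\<close>

lemma learn_le_iff:
  "learn_le A B \<longleftrightarrow> (\<exists>\<Psi>. effective \<Psi> \<and> (\<forall>g\<in>B. \<exists>e p. (\<exists>N. \<forall>n\<ge>N. \<Psi> (g \<restriction> n) = e) \<and>
    Phi e g = Some p \<and> p \<in> A))"
proof
  assume "learn_le A B"
  then obtain \<Gamma> \<Psi> where \<Psi>: "effective \<Psi>" "B \<subseteq> dom \<Gamma>" "\<forall>g\<in>B. the (\<Gamma> g) \<in> A"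
    "\<forall>g\<in>dom \<Gamma>. convergent (\<lambda>n. \<Psi> (g \<restriction> n)) \<and> Phi (lim (\<lambda>n. \<Psi> (g \<restriction> n))) g = \<Gamma> g"
    unfolding learn_le_def computable_on_strings_iff by blast
  have "\<exists>e p. (\<exists>N. \<forall>n\<ge>N. \<Psi> (g \<restriction> n) = e) \<and> Phi e g = Some p \<and> p \<in> A" if g: "g \<in> B" for g
  proof -
    from \<Psi>(2) g obtain p where p: "\<Gamma> g = Some p" by blast
    have "(\<lambda>n. \<Psi> (g \<restriction> n)) \<longlonglongrightarrow> lim (\<lambda>n. \<Psi> (g \<restriction> n))"
      using \<Psi>(4) p convergent_LIMSEQ_iff by blast
    then have "\<exists>N. \<forall>n\<ge>N. \<Psi> (g \<restriction> n) = lim (\<lambda>n. \<Psi> (g \<restriction> n))"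
      by (simp add: tendsto_discrete eventually_sequentially)
    moreover have "Phi (lim (\<lambda>n. \<Psi> (g \<restriction> n))) g = Some p"
      using \<Psi>(4) p by (metis domI)
    moreover have "p \<in> A" using \<Psi>(3) g p by force
    ultimately show ?thesis by blast
  qed
  then show "\<exists>\<Psi>. effective \<Psi> \<and> (\<forall>g\<in>B. \<exists>e p. (\<exists>N. \<forall>n\<ge>N. \<Psi> (g \<restriction> n) = e) \<and>
    Phi e g = Some p \<and> p \<in> A)"
    using \<Psi>(1) by blast
next
  assume "\<exists>\<Psi>. effective \<Psi> \<and> (\<forall>g\<in>B. \<exists>e p. (\<exists>N. \<forall>n\<ge>N. \<Psi> (g \<restriction> n) = e) \<and>
    Phi e g = Some p \<and> p \<in> A)"
  then obtain \<Psi> where \<Psi>: "effective \<Psi>"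
    "\<And>g. g \<in> B \<Longrightarrow> \<exists>e p. (\<exists>N. \<forall>n\<ge>N. \<Psi> (g \<restriction> n) = e) \<and> Phi e g = Some p \<and> p \<in> A"
    by blast
  define \<Gamma> where "\<Gamma> = (\<lambda>g. Phi (lim (\<lambda>n. \<Psi> (g \<restriction> n))) g) |` B"
  have *: "convergent (\<lambda>n. \<Psi> (g \<restriction> n)) \<and> (\<exists>p\<in>A. \<Gamma> g = Some p)" if g: "g \<in> B" for g
  proof -
    from \<Psi>(2)[OF g] obtain e p where e: "\<exists>N. \<forall>n\<ge>N. \<Psi> (g \<restriction> n) = e" "Phi e g = Some p" "p \<in> A"
      by blast
    from e(1) have "(\<lambda>n. \<Psi> (g \<restriction> n)) \<longlonglongrightarrow> e"
      by (simp add: tendsto_discrete eventually_sequentially)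
    then show ?thesis using e g limI by (auto simp: \<Gamma>_def convergent_def)
  qed
  show "learn_le A B"
    unfolding learn_le_def computable_on_strings_iff
  proof (intro exI[of _ \<Gamma>] exI[of _ \<Psi>] conjI ballI)
    show "B \<subseteq> dom \<Gamma>" using * by blast
    show "the (\<Gamma> g) \<in> A" if "g \<in> B" for g using *[OF that] by auto
    fix g assume "g \<in> dom \<Gamma>"
    then have "g \<in> B" by (auto simp: \<Gamma>_def restrict_map_def split: if_splits)
    then show "convergent (\<lambda>n. \<Psi> (g \<restriction> n))" "Phi (lim (\<lambda>n. \<Psi> (g \<restriction> n))) g = \<Gamma> g"
      using * by (auto simp: \<Gamma>_def)
  qed (rule \<Psi>(1))
qed

lemma learn_leE:
  assumes "learn_le A B"
  obtains \<Psi> where "effective \<Psi>"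
    "\<And>g. g \<in> B \<Longrightarrow> \<exists>e p. (\<exists>N. \<forall>n\<ge>N. \<Psi> (g \<restriction> n) = e) \<and> Phi e g = Some p \<and> p \<in> A"
  using assms unfolding learn_le_iff by blast

text \<open>When every answer of \<open>G\<close> is right, it no longer matters which one is found
  first, and the least stage of \<open>search_index\<close> disappears.\<close>

lemma learn_index:
  fixes G :: "nat list \<times> nat \<times> nat \<Rightarrow> nat"
  assumes "effective G"
  obtains ix where "effective ix"
    and "\<And>c h p. (\<And>k. \<exists>s. G (h \<restriction> s, c, k) \<noteq> 0) \<Longrightarrow>
      (\<And>k s. G (h \<restriction> s, c, k) \<noteq> 0 \<Longrightarrow> G (h \<restriction> s, c, k) = Suc (p k)) \<Longrightarrow> Phi (ix c) h = Some p"
proof -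
  from search_index[OF assms] obtain ix where ix: "effective ix"
    "\<And>c h. (\<And>k. \<exists>s. G (h \<restriction> s, c, k) \<noteq> 0) \<Longrightarrow>
      Phi (ix c) h = Some (\<lambda>k. G (h \<restriction> (LEAST s. G (h \<restriction> s, c, k) \<noteq> 0), c, k) - 1)"
    by blast
  have "Phi (ix c) h = Some p"
    if ex: "\<And>k. \<exists>s. G (h \<restriction> s, c, k) \<noteq> 0"
      and val: "\<And>k s. G (h \<restriction> s, c, k) \<noteq> 0 \<Longrightarrow> G (h \<restriction> s, c, k) = Suc (p k)" for c h p
  proof -
    have "G (h \<restriction> (LEAST s. G (h \<restriction> s, c, k) \<noteq> 0), c, k) - 1 = p k" for k
      using val[OF LeastI_ex[OF ex[of k]]] by simp
    then show ?thesis using ix(2)[OF ex] by simp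
  qed
  then show ?thesis using that ix(1) by blast
qed

text \<open>The list stops at the first argument without a value, so that it is an initial segment
  of the output and not a table with gaps.\<close>

definition approx :: "nat \<Rightarrow> nat list \<Rightarrow> nat \<Rightarrow> nat \<Rightarrow> nat list" where
  "approx s \<sigma> e n = rec_nat [] (\<lambda>k r. if length r = k \<and> eval_bounded s \<sigma> e k \<noteq> 0
     then r @ [eval_bounded s \<sigma> e k - 1] else r) n"

lemma effective_approx [eff]:
  assumes "effective s" "effective \<sigma>" "effective e" "effective n"
  shows "effective (\<lambda>x. approx (s x) (\<sigma> x) (e x) (n x))"
  unfolding approx_def
  by (intro eff assms assms[THEN effective_comp])

lemma approx_eq:
  assumes "Phi e F = Some p"
  shows "approx s (F \<restriction> m) e n = p \<restriction> length (approx s (F \<restriction> m) e n)"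
proof (induction n)
  case (Suc n)
  have "eval_bounded s (F \<restriction> m) e n - 1 = p n" if "eval_bounded s (F \<restriction> m) e n \<noteq> 0"
    using eval_bounded_unique[OF _ that] assms by (auto simp: Phi_eq_Some_iff)
  then show ?case using Suc by (auto simp: approx_def initial_segment_def)
qed (simp add: approx_def initial_segment_def)

lemma length_approx:
  assumes "Phi e F = Some p"
  shows "\<exists>N. \<forall>s\<ge>N. L \<le> length (approx s (F \<restriction> s) e s)"
proof -
  have "\<forall>i. \<exists>N. \<forall>s\<ge>N. eval_bounded s (F \<restriction> s) e i \<noteq> 0"
    using eval_bounded_complete assms unfolding Phi_eq_Some_iff by (metis nat.distinct(1))
  then obtain N where N: "\<And>i s. s \<ge> N i \<Longrightarrow> eval_bounded s (F \<restriction> s) e i \<noteq> 0" by metis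
  \<comment> \<open>\<open>M\<close> bounds the waiting times of the first \<open>L\<close>
    arguments and also \<open>L\<close> itself, because at stage \<open>s\<close> only
    \<open>s\<close> values are asked for.\<close>
  define M where "M = Max (insert L (N ` {..<L}))"
  have "L \<le> length (approx s (F \<restriction> s) e s)" if s: "s \<ge> M" for s
  proof -
    have M: "L \<le> M" "i < L \<Longrightarrow> N i \<le> M" for i by (auto simp: M_def)
    have "length (approx s (F \<restriction> s) e n) = n" if "n \<le> L" for n
      using that
    proof (induction n)
      case (Suc n)
      then have "eval_bounded s (F \<restriction> s) e n \<noteq> 0"
        using N[of n s] M(2)[of n] s by simp
      then show ?case using Suc by (simp add: approx_def)
    qed (simp add: approx_def)
    moreover have "length (approx s (F \<restriction> s) e n) \<le> length (approx s (F \<restriction> s) e (n + d))" for n d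
      by (induction d) (auto simp: approx_def)
    ultimately show ?thesis using M(1) s by (metis le_Suc_ex le_trans order_refl)
  qed
  then show ?thesis by blast
qed

lemma learn_le_trans:
  assumes "learn_le A B" "learn_le B C"
  shows "learn_le A C"
proof -
  obtain \<Psi>\<^sub>1 where \<Psi>1: "effective \<Psi>\<^sub>1"
    "\<And>f. f \<in> B \<Longrightarrow> \<exists>e p. (\<exists>N. \<forall>n\<ge>N. \<Psi>\<^sub>1 (f \<restriction> n) = e) \<and> Phi e f = Some p \<and> p \<in> A"
    using learn_leE[OF assms(1)] by blast
  obtain \<Psi>\<^sub>2 where \<Psi>2: "effective \<Psi>\<^sub>2"
    "\<And>g. g \<in> C \<Longrightarrow> \<exists>e f. (\<exists>N. \<forall>n\<ge>N. \<Psi>\<^sub>2 (g \<restriction> n) = e) \<and> Phi e g = Some f \<and> f \<in> B"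
    using learn_leE[OF assms(2)] by blast
  define a where "a z e = approx (length z) z e (length z)" for z e
  have a [eff]: "effective (\<lambda>x. a (z x) (e x))" if "effective z" "effective e"
    for z and e :: "'a :: encodable \<Rightarrow> nat"
    unfolding a_def by (intro eff that)
  define G where "G = (\<lambda>(z, c, k). eval_bounded (length z)
    (a z (snd (prod_decode c))) (fst (prod_decode c)) k)"
  have "effective G" unfolding G_def case_prod_unfold by (intro eff)
  from learn_index[OF this] obtain ix where ix: "effective ix"
    "\<And>c h p. (\<And>k. \<exists>s. G (h \<restriction> s, c, k) \<noteq> 0) \<Longrightarrow>
      (\<And>k s. G (h \<restriction> s, c, k) \<noteq> 0 \<Longrightarrow> G (h \<restriction> s, c, k) = Suc (p k)) \<Longrightarrow> Phi (ix c) h = Some p"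
    by metis
  define \<Psi> where "\<Psi> z = ix (prod_encode (\<Psi>\<^sub>1 (a z (\<Psi>\<^sub>2 z)), \<Psi>\<^sub>2 z))" for z
  have "effective \<Psi>"
    unfolding \<Psi>_def by (intro eff effective_comp[OF ix(1)] effective_comp[OF \<Psi>1(1)] effective_comp[OF \<Psi>2(1)])
  moreover have "\<exists>e p. (\<exists>N. \<forall>n\<ge>N. \<Psi> (g \<restriction> n) = e) \<and> Phi e g = Some p \<and> p \<in> A" if g: "g \<in> C" for g
  proof -
    from \<Psi>2(2)[OF g] obtain e2 f N2 where 2: "\<And>n. n \<ge> N2 \<Longrightarrow> \<Psi>\<^sub>2 (g \<restriction> n) = e2"
      "Phi e2 g = Some f" "f \<in> B" by blast
    from \<Psi>1(2)[OF 2(3)] obtain e1 p N1 where 1: "\<And>n. n \<ge> N1 \<Longrightarrow> \<Psi>\<^sub>1 (f \<restriction> n) = e1"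
      "Phi e1 f = Some p" "p \<in> A" by blast
    have af: "a (g \<restriction> n) e2 = f \<restriction> length (a (g \<restriction> n) e2)" for n
      unfolding a_def length_initial_segment by (rule approx_eq[OF 2(2)])
    have al: "\<exists>N. \<forall>s\<ge>N. L \<le> length (a (g \<restriction> s) e2)" for L
      unfolding a_def length_initial_segment by (rule length_approx[OF 2(2)])
    from al obtain N3 where N3: "\<forall>s\<ge>N3. N1 \<le> length (a (g \<restriction> s) e2)" by blast
    have "\<Psi> (g \<restriction> n) = ix (prod_encode (e1, e2))" if "n \<ge> max N2 N3" for n
    proof -
      have "\<Psi>\<^sub>1 (a (g \<restriction> n) e2) = e1" using 1(1)[of "length (a (g \<restriction> n) e2)"] N3 that af[of n] by simp
      then show ?thesis using that 2(1) by (simp add: \<Psi>_def)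
    qed
    moreover have "Phi (ix (prod_encode (e1, e2))) g = Some p"
    proof (rule ix(2))
      show "\<exists>s. G (g \<restriction> s, prod_encode (e1, e2), k) \<noteq> 0" for k
      proof -
        from eval_bounded_complete[of e1 f k] 1(2) obtain N
          where N: "\<forall>s\<ge>N. \<forall>m\<ge>N. eval_bounded s (f \<restriction> m) e1 k = Suc (p k)"
          by (auto simp: Phi_eq_Some_iff)
        from al obtain M where M: "\<forall>s\<ge>M. N \<le> length (a (g \<restriction> s) e2)" by blast
        let ?s = "max N M"
        have "eval_bounded ?s (a (g \<restriction> ?s) e2) e1 k = Suc (p k)"
          using N M by (subst af) auto
        then have "G (g \<restriction> ?s, prod_encode (e1, e2), k) \<noteq> 0" by (simp add: G_def odd_iff_mod_2_eq_one)
        then show ?thesis by blast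
      qed
      show "G (g \<restriction> s, prod_encode (e1, e2), k) = Suc (p k)"
        if "G (g \<restriction> s, prod_encode (e1, e2), k) \<noteq> 0" for k s
      proof -
        have "G (g \<restriction> s, prod_encode (e1, e2), k)
            = eval_bounded s (f \<restriction> length (a (g \<restriction> s) e2)) e1 k"
          by (subst af[symmetric]) (simp add: G_def)
        then show ?thesis
          using that eval_bounded_unique[of e1 f k "p k" s] 1(2) by (simp add: Phi_eq_Some_iff)
      qed
    qed
    ultimately show ?thesis using 1(3) by blast
  qed
  ultimately show ?thesis unfolding learn_le_iff by blast
qed

text \<open>\<open>degree_join\<close> collects the joins of all representatives, so the given one
  has to be exchanged for Q in the left factor. Even positions are translated, odd ones
  copied.\<close>

lemma learn_le_set_join_left:
  assumes "learn_le A B"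
  shows "learn_le (set_join A C) (set_join B C)"
proof -
  obtain \<Psi> where \<Psi>: "effective \<Psi>"
    "\<And>f. f \<in> B \<Longrightarrow> \<exists>e p. (\<exists>N. \<forall>n\<ge>N. \<Psi> (f \<restriction> n) = e) \<and> Phi e f = Some p \<and> p \<in> A"
    using learn_leE[OF assms] by blast
  define ev where "ev z = (\<lambda>i. get z (2 * i)) \<restriction> (length z div 2)" for z
  have ev_eff [eff]: "effective (\<lambda>x. ev (z x))" if "effective z" for z :: "'a :: encodable \<Rightarrow> nat list"
    unfolding ev_def by (intro eff that that[THEN effective_comp])
  have ev: "ev (baire_join f g \<restriction> n) = f \<restriction> (n div 2)" for f g n
    by (rule nth_equalityI) (auto simp: ev_def initial_segment_def get_def baire_join_def)
  define G where "G = (\<lambda>(z, e, k). if k mod 2 = 0 then eval_bounded (length z) (ev z) e (k div 2)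
    else if k < length z then Suc (get z k) else 0)"
  have "effective G" unfolding G_def case_prod_unfold by (intro eff)
  from learn_index[OF this] obtain ix where ix: "effective ix"
    "\<And>c h p. (\<And>k. \<exists>s. G (h \<restriction> s, c, k) \<noteq> 0) \<Longrightarrow>
      (\<And>k s. G (h \<restriction> s, c, k) \<noteq> 0 \<Longrightarrow> G (h \<restriction> s, c, k) = Suc (p k)) \<Longrightarrow> Phi (ix c) h = Some p"
    by metis
  have "effective (\<lambda>z. ix (\<Psi> (ev z)))"
    by (intro eff effective_comp[OF ix(1)] effective_comp[OF \<Psi>(1)])
  moreover have "\<exists>e p. (\<exists>N. \<forall>n\<ge>N. ix (\<Psi> (ev (h \<restriction> n))) = e) \<and> Phi e h = Some p \<and> p \<in> set_join A C"
    if "h \<in> set_join B C" for h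
  proof -
    from that obtain f g where h: "h = baire_join f g" and fg: "f \<in> B" "g \<in> C"
      by (auto simp: set_join_def)
    from \<Psi>(2)[OF fg(1)] obtain e p N where e: "\<And>n. n \<ge> N \<Longrightarrow> \<Psi> (f \<restriction> n) = e"
      "Phi e f = Some p" "p \<in> A" by blast
    have "ix (\<Psi> (ev (h \<restriction> n))) = ix e" if "n \<ge> 2 * N" for n
      using e(1)[of "n div 2"] that by (simp add: h ev)
    moreover have "Phi (ix e) h = Some (baire_join p g)"
    proof (rule ix(2))
      fix k
      show "\<exists>s. G (h \<restriction> s, e, k) \<noteq> 0"
      proof (cases "even k")
        case True
        from eval_bounded_complete[of e f "k div 2"] e(2) obtain N
          where N: "\<forall>s\<ge>N. \<forall>m\<ge>N. eval_bounded s (f \<restriction> m) e (k div 2) = Suc (p (k div 2))"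
          by (auto simp: Phi_eq_Some_iff)
        then have "G (h \<restriction> (2 * N), e, k) \<noteq> 0" using True by (simp add: G_def h ev)
        then show ?thesis by blast
      next
        case False
        then have "G (h \<restriction> Suc k, e, k) \<noteq> 0" by (simp add: G_def odd_iff_mod_2_eq_one)
        then show ?thesis by blast
      qed
      show "G (h \<restriction> s, e, k) = Suc (baire_join p g k)" if "G (h \<restriction> s, e, k) \<noteq> 0" for s
      proof (cases "even k")
        case True
        then show ?thesis
          using that eval_bounded_unique[of e f "k div 2" "p (k div 2)" s "s div 2"] e(2)
          by (simp add: G_def h ev Phi_eq_Some_iff) (simp add: baire_join_def)
      next
        case False
        then show ?thesis using that by (auto simp: G_def h odd_iff_mod_2_eq_one baire_join_def split: if_splits)
      qed
    qed
    ultimately show ?thesis using e(3) fg(2) unfolding set_join_def by blast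
  qed
  ultimately show ?thesis unfolding learn_le_iff by blast
qed

lemma mem_deg: "B \<in> deg A \<longleftrightarrow> learn_le A B \<and> learn_le B A"
  by (auto simp: deg_def learn_equiv_def)

lemma strong_anticuppingI:
  assumes "Pi01 Q" "Q \<noteq> {}" "Q \<notin> zero_degree"
    and anticup: "\<And>C. learn_le P (set_join Q C) \<Longrightarrow> learn_le P C"
  shows "strong_anticupping (deg P)"
  unfolding strong_anticupping_def
proof (intro bexI[of _ "deg Q"] conjI ballI impI)
  show "deg Q \<in> P1w" using assms(1,2) by (auto simp: P1w_def)
  show "deg Q \<noteq> zero_degree" using assms(3) learn_le_refl mem_deg by blast
  fix c assume c: "c \<in> degrees" and le: "degree_le (deg P) (degree_join (deg Q) c)"
  from le obtain A B Q' C where mem: "A \<in> deg P" "B \<in> deg (set_join Q' C)" "Q' \<in> deg Q" "C \<in> c"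
    and AB: "learn_le A B"
    unfolding degree_le_def degree_join_def by blast
  have "learn_le P B" using mem(1) AB learn_le_trans mem_deg by blast
  then have "learn_le P (set_join Q C)"
    using mem(2,3) learn_le_set_join_left learn_le_trans mem_deg by meson
  then have "learn_le P C" by (rule anticup)
  then show "degree_le (deg P) c"
    using mem(4) learn_le_refl mem_deg unfolding degree_le_def by blast
qed

section \<open>Binary trees and their paths\<close>

text \<open>\<open>R\<close> need not be closed under prefixes. Quantifying over all prefixes closes
  it without changing the paths.\<close>

definition tree :: "(nat list \<Rightarrow> bool) \<Rightarrow> nat list \<Rightarrow> bool" where
  "tree R xs \<longleftrightarrow> (\<forall>n<Suc (length xs). R (take n xs)) \<and> (\<forall>i<length xs. get xs i \<le> 1)"

definition paths :: "(nat list \<Rightarrow> bool) \<Rightarrow> baire set" where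
  "paths R = {f \<in> cantor. \<forall>n. R (f \<restriction> n)}"

lemma Pi01_iff_paths: "Pi01 P \<longleftrightarrow> (\<exists>R. effective R \<and> P = paths R)"
proof -
  have "effective (\<lambda>s. of_bool (R s) :: nat) \<longleftrightarrow> effective R" for R :: "nat list \<Rightarrow> bool"
    using effective_cong_enc[of R "\<lambda>s. of_bool (R s) :: nat"] effective_of_bool by auto
  then show ?thesis by (simp add: Pi01_def computable_on_strings_iff paths_def)
qed

lemma effective_tree [eff]:
  assumes "effective R" "effective xs" shows "effective (\<lambda>x. tree R (xs x))"
  unfolding tree_def by (intro eff assms effective_comp[OF assms(1)] effective_comp[OF assms(2)])

lemma initial_segment_Suc: "f \<restriction> Suc n = f \<restriction> n @ [f n]"
  by (simp add: initial_segment_def)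

lemma initial_segment_0 [simp]: "f \<restriction> 0 = []"
  by (simp add: initial_segment_def)

lemma take_initial_segment [simp]: "take m (f \<restriction> n) = f \<restriction> min m n"
  by (simp add: initial_segment_def take_map min_def)

lemma nth_initial_segment [simp]: "i < n \<Longrightarrow> (f \<restriction> n) ! i = f i"
  by (simp add: initial_segment_def)

lemma prefix_initial_segment: "m \<le> n \<Longrightarrow> prefix (f \<restriction> m) (f \<restriction> n)"
  by (metis min.absorb1 take_initial_segment take_is_prefix)

lemma prefix_initial_segmentD: "prefix xs (f \<restriction> n) \<Longrightarrow> xs = f \<restriction> length xs"
  by (metis length_initial_segment min.absorb1 prefix_length_le take_initial_segment prefix_def
      append_eq_conv_conj)

lemma tree_Nil [simp]: "tree R [] \<longleftrightarrow> R []"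
  by (simp add: tree_def)

lemma tree_snoc: "tree R (xs @ [b]) \<longleftrightarrow> tree R xs \<and> R (xs @ [b]) \<and> b \<le> 1"
  unfolding tree_def get_def by (auto simp: less_Suc_eq nth_append)

lemma treeD: "tree R xs \<Longrightarrow> R xs"
  by (auto simp: tree_def)

lemma tree_prefix: "tree R ys \<Longrightarrow> prefix xs ys \<Longrightarrow> tree R xs"
proof -
  have "tree R (xs @ zs) \<Longrightarrow> tree R xs" for zs
    by (induction zs rule: rev_induct) (auto simp: tree_snoc simp flip: append_assoc)
  then show "tree R ys \<Longrightarrow> prefix xs ys \<Longrightarrow> tree R xs" by (auto simp: prefix_def)
qed

lemma mem_paths_iff: "f \<in> paths R \<longleftrightarrow> (\<forall>n. tree R (f \<restriction> n))"
proof
  assume f: "f \<in> paths R"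
  show "\<forall>n. tree R (f \<restriction> n)"
  proof
    have "f n \<in> {0, 1}" for n using f unfolding paths_def cantor_def by blast
    then have "f n \<le> 1" for n by (metis insertE le_refl less_one less_or_eq_imp_le singletonD)
    moreover have "R (f \<restriction> n)" for n using f by (simp add: paths_def)
    ultimately show "tree R (f \<restriction> n)" for n
      by (induction n) (metis initial_segment_0 tree_Nil, metis initial_segment_Suc tree_snoc)
  qed
next
  assume t: "\<forall>n. tree R (f \<restriction> n)"
  then have "f n \<in> {0, 1}" for n
    using t[rule_format, of "Suc n"] by (auto simp: initial_segment_Suc tree_snoc)
  then show "f \<in> paths R" using t treeD by (auto simp: paths_def cantor_def)
qed

lemma mem_pathsI:
  assumes "\<And>L. \<exists>n\<ge>L. tree R (f \<restriction> n)" shows "f \<in> paths R"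
  unfolding mem_paths_iff using assms tree_prefix prefix_initial_segment by blast

section \<open>Limits of chains of strings\<close>

lemma prefix_chain_mono:
  assumes "\<And>n. prefix (X n) (X (Suc n))" "m \<le> n" shows "prefix (X m) (X n)"
  using assms(2) by (induction n rule: dec_induct) (auto intro: assms(1) prefix_order.trans)

lemma prefix_chain_limit:
  assumes chain: "\<And>n. prefix (X n) (X (Suc n))" and unb: "\<And>L. \<exists>n. L \<le> length (X n)"
  obtains F where "\<And>n. X n = F \<restriction> length (X n)"
proof -
  obtain N where N: "\<And>L. L \<le> length (X (N L))" using unb by metis
  have "X n = (\<lambda>i. X (N (Suc i)) ! i) \<restriction> length (X n)" for n
  proof (rule nth_equalityI)
    fix i assume i: "i < length (X n)"
    have i': "i < length (X (N (Suc i)))" using N[of "Suc i"] by simp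
    have "X n ! i = X (N (Suc i)) ! i"
      using prefix_chain_mono[of X, OF chain] i i'
      by (metis nle_le nth_append prefix_def)
    then show "X n ! i = ((\<lambda>i. X (N (Suc i)) ! i) \<restriction> length (X n)) ! i" using i by simp
  qed simp
  then show ?thesis by (rule that)
qed

lemma prefix_chain_bounded:
  assumes chain: "\<And>n. n \<ge> N \<Longrightarrow> prefix (X n) (X (Suc n))"
    and bound: "\<not> (\<forall>L. \<exists>n\<ge>N. L \<le> length (X n))"
  obtains M where "M \<ge> N" "\<And>n. n \<ge> M \<Longrightarrow> X n = X M"
proof -
  from bound obtain L where "\<forall>n\<ge>N. \<not> L \<le> length (X n)" by blast
  then have "\<forall>n. n \<ge> N \<longrightarrow> length (X n) < L" by auto
  then obtain M where M: "M \<ge> N" "\<forall>n\<ge>N. length (X n) \<le> length (X M)"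
    using ex_has_greatest_nat[of "\<lambda>n. n \<ge> N" N "\<lambda>n. length (X n)" L] by (meson order.refl order.strict_implies_order)
  have "X n = X M" if "n \<ge> M" for n
    using that
  proof (induction n rule: dec_induct)
    case (step n)
    then show ?case
      using chain[of n] M by (metis le_trans prefix_length_prefix prefix_order.eq_iff le_SucI prefix_order.refl)
  qed simp
  then show ?thesis using M(1) that by blast
qed

text \<open>The stage \<open>N\<close> from which the strings form a chain need not be found
  effectively: it is finite information and enters the program as the parameter of
  \<open>learn_index\<close>.\<close>

lemma computable_path_of_chain:
  assumes t: "effective t" and f: "computable f"
    and chain: "\<And>n. n \<ge> N \<Longrightarrow> prefix (t (f \<restriction> n)) (t (f \<restriction> Suc n))"
    and tr: "\<And>n. n \<ge> N \<Longrightarrow> tree R (t (f \<restriction> n))"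
    and unb: "\<forall>L. \<exists>n\<ge>N. L \<le> length (t (f \<restriction> n))"
  shows "\<exists>p\<in>paths R. computable p"
proof -
  define X where "X n = t (f \<restriction> (N + n))" for n
  have unb': "\<exists>n. L \<le> length (X n)" for L
    using unb[rule_format, of L] unfolding X_def by (metis le_Suc_ex)
  from prefix_chain_limit[of X] obtain p where p: "\<And>n. X n = p \<restriction> length (X n)"
    using chain unb' by (auto simp: X_def)
  have "\<exists>n\<ge>L. tree R (p \<restriction> n)" for L
  proof -
    from unb' obtain n where n: "L \<le> length (X n)" by blast
    then show ?thesis using tr[of "N + n"] p[of n] X_def by auto
  qed
  then have "p \<in> paths R" by (rule mem_pathsI)
  moreover define G where
    "G = (\<lambda>(z, c, k). if c \<le> length z \<and> k < length (t z) then Suc (get (t z) k) else 0)"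
  have "effective G" unfolding G_def case_prod_unfold by (intro eff effective_comp[OF t])
  from learn_index[OF this] obtain ix where ix:
    "\<And>c h p. (\<And>k. \<exists>s. G (h \<restriction> s, c, k) \<noteq> 0) \<Longrightarrow>
      (\<And>k s. G (h \<restriction> s, c, k) \<noteq> 0 \<Longrightarrow> G (h \<restriction> s, c, k) = Suc (p k)) \<Longrightarrow> Phi (ix c) h = Some p"
    by metis
  have "Phi (ix N) f = Some p"
  proof (rule ix)
    fix k
    from unb obtain n where "n \<ge> N" "Suc k \<le> length (t (f \<restriction> n))" by blast
    then have "G (f \<restriction> n, N, k) \<noteq> 0" by (simp add: G_def)
    then show "\<exists>s. G (f \<restriction> s, N, k) \<noteq> 0" by blast
    show "G (f \<restriction> s, N, k) = Suc (p k)" if "G (f \<restriction> s, N, k) \<noteq> 0" for s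
    proof -
      from that have s: "N \<le> s" "k < length (t (f \<restriction> s))" by (auto simp: G_def split: if_splits)
      then have "t (f \<restriction> s) = p \<restriction> length (t (f \<restriction> s))" using p[of "s - N"] by (simp add: X_def)
      then have "get (t (f \<restriction> s)) k = p k" using s(2) by (metis get_initial_segment)
      then show ?thesis using s by (simp add: G_def)
    qed
  qed
  ultimately show ?thesis using computable_Phi[OF f] by blast
qed

section \<open>Three tapes\<close>

text \<open>A binary sequence is read as a list of instructions in a prefix code: \<open>0b\<close> appends \<open>b\<close> to
  tape 2, \<open>10b\<close> appends \<open>b\<close> to tape 1 and clears tape 2, and \<open>11b\<close> appends \<open>b\<close> to tape 0 and clears
  the other two. The first component is the position inside an instruction, 0 between instructions.\<close>

type_synonym tapes = "nat \<times> nat list \<times> nat list \<times> nat list"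

definition tape_step :: "tapes \<Rightarrow> nat \<Rightarrow> tapes" where
  "tape_step S b =
    (if fst S = 0 then (if b = 0 then 2 else 1, snd S)
     else if fst S = 1 then (if b = 0 then 3 else 4, snd S)
     else if fst S = 2 then (0, fst (snd S), fst (snd (snd S)), snd (snd (snd S)) @ [b])
     else if fst S = 3 then (0, fst (snd S), fst (snd (snd S)) @ [b], [])
     else (0, fst (snd S) @ [b], [], []))"

definition tapes :: "nat list \<Rightarrow> tapes" where
  "tapes xs = foldl (\<lambda>S b. tape_step S b) (0, [], [], []) xs"

definition "mode xs = fst (tapes xs)"
definition "tape\<^sub>0 xs = fst (snd (tapes xs))"
definition "tape\<^sub>1 xs = fst (snd (snd (tapes xs)))"
definition "tape\<^sub>2 xs = snd (snd (snd (tapes xs)))"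

lemmas tape_defs = mode_def tape\<^sub>0_def tape\<^sub>1_def tape\<^sub>2_def

lemma effective_tapes [eff]: "effective xs \<Longrightarrow> effective (\<lambda>x. tapes (xs x))"
  unfolding tapes_def tape_step_def by (intro eff)

lemma effective_tape [eff]:
  assumes "effective xs"
  shows "effective (\<lambda>x. mode (xs x))" "effective (\<lambda>x. tape\<^sub>0 (xs x))"
    "effective (\<lambda>x. tape\<^sub>1 (xs x))" "effective (\<lambda>x. tape\<^sub>2 (xs x))"
  unfolding tape_defs by (intro eff assms)+

lemma tapes_Nil: "tapes [] = (0, [], [], [])"
  by (simp add: tapes_def)

lemma tape_Nil [simp]: "mode [] = 0" "tape\<^sub>0 [] = []" "tape\<^sub>1 [] = []" "tape\<^sub>2 [] = []"
  by (simp_all add: tape_defs tapes_Nil)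

lemma tapes_snoc: "tapes (xs @ [b]) = tape_step (tapes xs) b"
  by (simp add: tapes_def)

lemma tapes_append: "tapes (xs @ ys) = foldl tape_step (tapes xs) ys"
  by (simp add: tapes_def)

lemma tape_cases:
  obtains "mode xs = 0" "tape\<^sub>0 (xs @ [b]) = tape\<^sub>0 xs" "tape\<^sub>1 (xs @ [b]) = tape\<^sub>1 xs"
    "tape\<^sub>2 (xs @ [b]) = tape\<^sub>2 xs" "mode (xs @ [b]) = (if b = 0 then 2 else 1)"
  | "mode xs = 1" "tape\<^sub>0 (xs @ [b]) = tape\<^sub>0 xs" "tape\<^sub>1 (xs @ [b]) = tape\<^sub>1 xs"
    "tape\<^sub>2 (xs @ [b]) = tape\<^sub>2 xs" "mode (xs @ [b]) = (if b = 0 then 3 else 4)"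
  | "mode xs = 2" "tape\<^sub>0 (xs @ [b]) = tape\<^sub>0 xs" "tape\<^sub>1 (xs @ [b]) = tape\<^sub>1 xs"
    "tape\<^sub>2 (xs @ [b]) = tape\<^sub>2 xs @ [b]" "mode (xs @ [b]) = 0"
  | "mode xs = 3" "tape\<^sub>0 (xs @ [b]) = tape\<^sub>0 xs" "tape\<^sub>1 (xs @ [b]) = tape\<^sub>1 xs @ [b]"
    "tape\<^sub>2 (xs @ [b]) = []" "mode (xs @ [b]) = 0"
  | "mode xs > 3" "tape\<^sub>0 (xs @ [b]) = tape\<^sub>0 xs @ [b]" "tape\<^sub>1 (xs @ [b]) = []"
    "tape\<^sub>2 (xs @ [b]) = []" "mode (xs @ [b]) = 0"
proof -
  note defs = tape_defs tapes_snoc tape_step_def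
  consider "mode xs = 0" | "mode xs = 1" | "mode xs = 2" | "mode xs = 3" | "mode xs > 3" by linarith
  then show ?thesis
  proof cases
    case 1
    then show ?thesis by (intro that(1)) (simp_all add: defs)
  next
    case 2
    then show ?thesis by (intro that(2)) (simp_all add: defs)
  next
    case 3
    then show ?thesis by (intro that(3)) (simp_all add: defs)
  next
    case 4
    then show ?thesis by (intro that(4)) (simp_all add: defs)
  next
    case 5
    then show ?thesis by (intro that(5)) (simp_all add: defs)
  qed
qed

section \<open>Legal scripts and the absence of computable ones\<close>

definition admissible :: "(nat list \<Rightarrow> bool) \<Rightarrow> nat list \<Rightarrow> bool" where
  "admissible R xs \<longleftrightarrow> R (tape\<^sub>0 xs) \<and> R (tape\<^sub>1 xs) \<and> R (tape\<^sub>2 xs)"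

abbreviation "legal R \<equiv> tree (admissible R)"

lemma effective_admissible: "effective R \<Longrightarrow> effective (admissible R)"
  unfolding admissible_def[abs_def] by (intro eff) (auto intro!: eff intro: effective_comp[of R])

text \<open>Although \<open>admissible\<close> inspects only the current tapes, a tape grows bit by
  bit from the empty string, so each prefix of its content was inspected at an earlier prefix of the
  script.\<close>

lemma legal_tapes:
  assumes "legal R xs" shows "tree R (tape\<^sub>0 xs)" "tree R (tape\<^sub>1 xs)" "tree R (tape\<^sub>2 xs)"
proof -
  have "tree R (tape\<^sub>0 xs) \<and> tree R (tape\<^sub>1 xs) \<and> tree R (tape\<^sub>2 xs)"
    using assms
  proof (induction xs rule: rev_induct)
    case Nil
    then show ?case by (simp add: admissible_def)
  next
    case (snoc b xs)
    then show ?case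
      by (cases xs b rule: tape_cases) (auto simp: tree_snoc admissible_def)
  qed
  then show "tree R (tape\<^sub>0 xs)" "tree R (tape\<^sub>1 xs)" "tree R (tape\<^sub>2 xs)" by blast+
qed

lemma legal_write:
  assumes "legal R xs" "mode xs = 0" "R []" "b \<le> 1"
  shows write\<^sub>2: "tapes (xs @ [0, b]) = (0, tape\<^sub>0 xs, tape\<^sub>1 xs, tape\<^sub>2 xs @ [b])"
      "R (tape\<^sub>2 xs @ [b]) \<Longrightarrow> legal R (xs @ [0, b])"
    and write\<^sub>1: "tapes (xs @ [1, 0, b]) = (0, tape\<^sub>0 xs, tape\<^sub>1 xs @ [b], [])"
      "R (tape\<^sub>1 xs @ [b]) \<Longrightarrow> legal R (xs @ [1, 0, b])"
    and write\<^sub>0: "tapes (xs @ [1, 1, b]) = (0, tape\<^sub>0 xs @ [b], [], [])"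
      "R (tape\<^sub>0 xs @ [b]) \<Longrightarrow> legal R (xs @ [1, 1, b])"
proof -
  have eqs: "xs @ [0, b] = (xs @ [0]) @ [b]" "xs @ [1, 0, b] = ((xs @ [1]) @ [0]) @ [b]"
    "xs @ [1, 1, b] = ((xs @ [1]) @ [1]) @ [b]" by simp_all
  have adm: "R (tape\<^sub>0 xs)" "R (tape\<^sub>1 xs)" "R (tape\<^sub>2 xs)"
    using treeD[OF assms(1)] by (auto simp: admissible_def)
  show "tapes (xs @ [0, b]) = (0, tape\<^sub>0 xs, tape\<^sub>1 xs, tape\<^sub>2 xs @ [b])"
    "tapes (xs @ [1, 0, b]) = (0, tape\<^sub>0 xs, tape\<^sub>1 xs @ [b], [])"
    "tapes (xs @ [1, 1, b]) = (0, tape\<^sub>0 xs @ [b], [], [])"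
    using assms(2) unfolding eqs tapes_snoc by (simp_all add: tape_step_def tape_defs)
  show "R (tape\<^sub>2 xs @ [b]) \<Longrightarrow> legal R (xs @ [0, b])"
    "R (tape\<^sub>1 xs @ [b]) \<Longrightarrow> legal R (xs @ [1, 0, b])"
    "R (tape\<^sub>0 xs @ [b]) \<Longrightarrow> legal R (xs @ [1, 1, b])"
    using assms adm unfolding eqs tree_snoc
    by (simp_all add: admissible_def tape_defs tapes_append tape_step_def)
qed

text \<open>Once all tapes of smaller number are at rest, a tape is never cleared again, so its
  contents form a chain. Which tape keeps growing is settled by a classical case
  distinction.\<close>

lemma computable_path_of_tapes:
  assumes f: "f \<in> paths (admissible R)" "computable f"
  shows "\<exists>p\<in>paths R. computable p"
proof -
  have legal: "legal R (f \<restriction> n)" for n using f(1) by (simp add: mem_paths_iff)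
  note trees = legal_tapes[OF legal]
  have eff: "effective tape\<^sub>0" "effective tape\<^sub>1" "effective tape\<^sub>2" by (intro eff)+
  note path = computable_path_of_chain[OF _ f(2)]
  have chain0: "prefix (tape\<^sub>0 (f \<restriction> n)) (tape\<^sub>0 (f \<restriction> Suc n))" for n
    unfolding initial_segment_Suc by (cases "f \<restriction> n" "f n" rule: tape_cases) auto
  show ?thesis
  proof (cases "\<forall>L. \<exists>n\<ge>0. L \<le> length (tape\<^sub>0 (f \<restriction> n))")
    case True
    show ?thesis by (rule path[OF eff(1) chain0 trees(1) True])
  next
    case False
    from prefix_chain_bounded[OF chain0 False] obtain N
      where N: "\<And>n. n \<ge> N \<Longrightarrow> tape\<^sub>0 (f \<restriction> n) = tape\<^sub>0 (f \<restriction> N)" by blast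
    have N': "tape\<^sub>0 (f \<restriction> n @ [f n]) = tape\<^sub>0 (f \<restriction> n)" if "n \<ge> N" for n
      using N[of n] N[of "Suc n"] that by (simp add: initial_segment_Suc)
    have chain1: "prefix (tape\<^sub>1 (f \<restriction> n)) (tape\<^sub>1 (f \<restriction> Suc n))" if "n \<ge> N" for n
      using N'[OF that] unfolding initial_segment_Suc
      by (cases "f \<restriction> n" "f n" rule: tape_cases) auto
    show ?thesis
    proof (cases "\<forall>L. \<exists>n\<ge>N. L \<le> length (tape\<^sub>1 (f \<restriction> n))")
      case True
      show ?thesis by (rule path[OF eff(2) chain1 trees(2) True])
    next
      case False
      from prefix_chain_bounded[OF chain1 False] obtain M
        where M: "M \<ge> N" "\<And>n. n \<ge> M \<Longrightarrow> tape\<^sub>1 (f \<restriction> n) = tape\<^sub>1 (f \<restriction> M)" by blast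
      have M': "tape\<^sub>1 (f \<restriction> n @ [f n]) = tape\<^sub>1 (f \<restriction> n)"
        "tape\<^sub>0 (f \<restriction> n @ [f n]) = tape\<^sub>0 (f \<restriction> n)" if "n \<ge> M" for n
        using M(2)[of n] M(2)[of "Suc n"] N'[of n] M(1) that by (simp_all add: initial_segment_Suc)
      have chain2: "prefix (tape\<^sub>2 (f \<restriction> n)) (tape\<^sub>2 (f \<restriction> Suc n))" if "n \<ge> M" for n
        using M'[OF that] unfolding initial_segment_Suc
        by (cases "f \<restriction> n" "f n" rule: tape_cases) auto
      \<comment> \<open>Modes 3 and 4 would write on tape 1 or tape 0, which are at rest.\<close>
      have low: "mode (f \<restriction> n) \<in> {0, 1, 2}" if "n \<ge> M" for n
        using M'[OF that] by (cases "f \<restriction> n" "f n" rule: tape_cases) auto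
      \<comment> \<open>Mode 1 drops out as well, since it leads to mode 3 or 4.\<close>
      have low': "mode (f \<restriction> n) \<in> {0, 2}" if "n \<ge> M" for n
        using low[OF that] low[of "Suc n"] that
        by (cases "f \<restriction> n" "f n" rule: tape_cases) (auto simp: initial_segment_Suc split: if_splits)
      have grow2: "length (tape\<^sub>2 (f \<restriction> Suc n)) = Suc (length (tape\<^sub>2 (f \<restriction> n)))"
        if "mode (f \<restriction> n) = 2" for n
        using that unfolding initial_segment_Suc
        by (cases "f \<restriction> n" "f n" rule: tape_cases) auto
      have step0: "mode (f \<restriction> Suc n) = 2 \<and> tape\<^sub>2 (f \<restriction> Suc n) = tape\<^sub>2 (f \<restriction> n)"
        if "mode (f \<restriction> n) = 0" "n \<ge> M" for n
        using that low'[of "Suc n"] unfolding initial_segment_Suc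
        by (cases "f \<restriction> n" "f n" rule: tape_cases) (auto split: if_splits)
      have grow: "\<exists>m\<ge>n. Suc (length (tape\<^sub>2 (f \<restriction> n))) \<le> length (tape\<^sub>2 (f \<restriction> m))" if "n \<ge> M" for n
        using low'[OF that] grow2[of n] grow2[of "Suc n"] step0[OF _ that]
        by (metis empty_iff insertE le_SucI le_refl)
      have "\<exists>n\<ge>M. L \<le> length (tape\<^sub>2 (f \<restriction> n))" for L
      proof (induction L)
        case (Suc L)
        then show ?case using grow by (meson Suc_le_mono le_trans)
      qed blast
      then show ?thesis using path[OF eff(3) chain2 trees(3)] by blast
    qed
  qed
qed

text \<open>After \<open>xs\<close> the bits of \<open>g\<close> are copied to tape 2; each inserted
  0 is the instruction prefix for that tape.\<close>

definition wait :: "nat list \<Rightarrow> baire \<Rightarrow> baire" where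
  "wait xs g = (\<lambda>i. if i < length xs then xs ! i
    else if even (i - length xs) then 0 else g ((i - length xs) div 2))"

lemma wait_prefix: "wait xs g \<restriction> length xs = xs"
  by (rule nth_equalityI) (auto simp: wait_def)

text \<open>Starting with an empty tape 2, its content is always a segment of \<open>g\<close>, and
  this is why the tree never forbids the next bit.\<close>

lemma wait_properties:
  assumes "legal R xs" "mode xs = 0" "R []" "tape\<^sub>2 xs = []" "g \<in> paths R"
  shows "tapes (wait xs g \<restriction> (length xs + 2 * n)) = (0, tape\<^sub>0 xs, tape\<^sub>1 xs, g \<restriction> n)"
    and "legal R (wait xs g \<restriction> (length xs + 2 * n))"
proof -
  have g: "tree R (g \<restriction> n)" for n using assms(5) by (simp add: mem_paths_iff)
  have "tapes (wait xs g \<restriction> (length xs + 2 * n)) = (0, tape\<^sub>0 xs, tape\<^sub>1 xs, g \<restriction> n)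
      \<and> legal R (wait xs g \<restriction> (length xs + 2 * n))"
  proof (induction n)
    case 0
    then show ?case using assms by (simp add: wait_prefix prod_eq_iff tape_defs)
  next
    case (Suc n)
    let ?w = "wait xs g \<restriction> (length xs + 2 * n)"
    have w: "wait xs g \<restriction> (length xs + 2 * Suc n) = ?w @ [0, g n]"
      by (simp add: initial_segment_Suc wait_def)
    have "R (g \<restriction> n @ [g n])" "g n \<le> 1"
      using g[of "Suc n"] by (simp_all add: initial_segment_Suc tree_snoc)
    then show ?case
      using Suc.IH write\<^sub>2[of R ?w "g n"] assms(3) unfolding w
      by (simp add: tape_defs initial_segment_Suc)
  qed
  then show "tapes (wait xs g \<restriction> (length xs + 2 * n)) = (0, tape\<^sub>0 xs, tape\<^sub>1 xs, g \<restriction> n)"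
    "legal R (wait xs g \<restriction> (length xs + 2 * n))" by blast+
qed

lemma wait_mem_paths:
  assumes "legal R xs" "mode xs = 0" "R []" "tape\<^sub>2 xs = []" "g \<in> paths R"
  shows "wait xs g \<in> paths (admissible R)"
proof (rule mem_pathsI)
  show "\<exists>n\<ge>L. legal R (wait xs g \<restriction> n)" for L
    using wait_properties(2)[OF assms, of L] by (intro exI[of _ "length xs + 2 * L"]) simp
qed

section \<open>The learner\<close>

text \<open>What the learner sees of the join when the script is known up to \<open>x\<close>. It is
  meaningful only if \<open>z\<close> is at least as long as \<open>x\<close>; otherwise defaults of
  \<open>get\<close> take the place of oracle values.\<close>

definition merge :: "nat list \<Rightarrow> nat list \<Rightarrow> nat list" where
  "merge x z = baire_join (get x) (get z) \<restriction> (2 * length x)"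

lemma effective_merge [eff]:
  assumes "effective x" "effective z" shows "effective (\<lambda>i. merge (x i) (z i))"
  unfolding merge_def baire_join_def by (intro eff assms assms[THEN effective_comp])

lemma initial_segment_get: "get x \<restriction> length x = x"
  by (rule nth_equalityI) (auto simp: get_def)

lemma merge_initial_segment:
  assumes "x = F \<restriction> length x" "length x \<le> s"
  shows "merge x (h \<restriction> s) = baire_join F h \<restriction> (2 * length x)"
proof (rule nth_equalityI)
  fix i assume "i < length (merge x (h \<restriction> s))"
  then have i: "i < 2 * length x" by (simp add: merge_def)
  then have "get x (i div 2) = F (i div 2)"
    by (subst assms(1)) simp
  then show "merge x (h \<restriction> s) ! i = (baire_join F h \<restriction> (2 * length x)) ! i"
    using i assms(2) by (simp add: merge_def baire_join_def)
qed (simp add: merge_def)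

text \<open>The algorithm is defined before \<open>h\<close> and \<theta> are fixed, so that one
  effective function serves all oracles in \<open>C\<close>; the second locale adds them for the
  verification.\<close>

locale anticupping =
  fixes R :: "nat list \<Rightarrow> bool" and \<Psi> :: "nat list \<Rightarrow> nat"
  assumes effective_R: "effective R" and R_Nil: "R []" and effective_\<Psi>: "effective \<Psi>"
begin

definition start :: "nat list \<Rightarrow> bool" where
  "start x \<longleftrightarrow> legal R x \<and> mode x = 0 \<and> tape\<^sub>1 x = [] \<and> tape\<^sub>2 x = []"

text \<open>Every number has to name a candidate, so a code of an unsuitable string stands for the
  empty script.\<close>

definition node :: "nat \<Rightarrow> nat list" where
  "node c = (if start (list_decode c) then list_decode c else [])"

text \<open>A state consists of the number of the current candidate node and its extension so far. At stage
  \<open>s\<close> the only extension tested is the one coded by the first component of \<open>s\<close>, so that each of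
  them is tested at infinitely many stages.\<close>

definition advance :: "nat list \<Rightarrow> nat \<times> nat list \<Rightarrow> nat \<times> nat list" where
  "advance z q = (let s = length z; c = fst q; x = snd q; y = x @ list_decode (fst (prod_decode s));
      e = \<Psi> (merge (node c) z); u = eval_bounded s (merge y z) e (length (tape\<^sub>1 x))
    in if length y \<le> s \<and> legal R y \<and> mode y = 0 \<and> tape\<^sub>0 y = tape\<^sub>0 x then
         if \<Psi> (merge y z) = e then
           if tape\<^sub>1 y = tape\<^sub>1 x \<and> u \<noteq> 0 then
             if u \<le> 2 \<and> R (tape\<^sub>1 x @ [u - 1]) then (c, y @ [1, 0, u - 1])
             else (Suc c, node (Suc c))
           else q
         else (Suc c, node (Suc c))
       else q)"

text \<open>The fold carries the input read so far along with the state, because a stage consults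
  all of it.\<close>

definition state :: "nat list \<Rightarrow> nat \<times> nat list" where
  "state z = snd (foldl (\<lambda>w b. (fst w @ [b], advance (fst w) (snd w))) ([], 0, node 0) z)"

lemma state_Nil: "state [] = (0, node 0)"
  by (simp add: state_def)

lemma state_snoc: "state (z @ [b]) = advance z (state z)"
proof -
  have "fst (foldl (\<lambda>w b. (fst w @ [b], advance (fst w) (snd w))) ([], 0, node 0) z) = z"
    by (induction z rule: rev_induct) simp_all
  then show ?thesis by (simp add: state_def)
qed

lemma start_Nil: "start []"
  by (simp add: start_def admissible_def R_Nil)

lemma start_node: "start (node c)"
  by (simp add: node_def start_Nil)

lemma effective_node [eff]: "effective c \<Longrightarrow> effective (\<lambda>x. node (c x))"
  unfolding node_def start_def by (intro eff effective_admissible effective_R)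

lemma effective_state: "effective state"
  unfolding state_def[abs_def] advance_def Let_def
  by (intro eff effective_admissible effective_R effective_comp[OF effective_R]
      effective_comp[OF effective_\<Psi>])

text \<open>The candidate \<open>c\<close> is a parameter that the learner supplies. Stages with
  another candidate are silent, so abandoned outputs do not spoil the result.\<close>

definition emit :: "nat list \<times> nat \<times> nat \<Rightarrow> nat" where
  "emit = (\<lambda>(z, c, k). if fst (state z) = c \<and> k < length (tape\<^sub>1 (snd (state z)))
     then Suc (get (tape\<^sub>1 (snd (state z))) k) else 0)"

lemma effective_emit: "effective emit"
  unfolding emit_def case_prod_unfold by (intro eff effective_comp[OF effective_state])

end

section \<open>Verification for a fixed oracle\<close>

locale anticupping_oracle = anticupping +
  fixes h \<theta> :: baire
  assumes learns: "\<And>f. f \<in> paths (admissible R) \<Longrightarrow>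
      \<exists>e p. (\<exists>N. \<forall>n\<ge>N. \<Psi> (baire_join f h \<restriction> n) = e) \<and> Phi e (baire_join f h) = Some p \<and> p \<in> paths R"
    and \<theta>: "\<theta> \<in> paths R"
begin

definition guess :: "nat list \<Rightarrow> nat" where
  "guess x = \<Psi> (merge x (h \<restriction> length x))"

lemma guess_eq: "x = F \<restriction> length x \<Longrightarrow> guess x = \<Psi> (baire_join F h \<restriction> (2 * length x))"
  unfolding guess_def using merge_initial_segment[of x F "length x" h] by simp

lemma \<Psi>_merge: "length x \<le> s \<Longrightarrow> \<Psi> (merge x (h \<restriction> s)) = guess x"
  unfolding guess_def
  using merge_initial_segment[of x "get x" s h] merge_initial_segment[of x "get x" "length x" h]
  by (simp add: initial_segment_get)

text \<open>The last clause is the invariant of tape 1: it agrees with the output of the candidate's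
  guess. It speaks of all points through \<open>x\<close> at which this output is total, because the
  script is still unfinished.\<close>

definition consistent :: "nat \<Rightarrow> nat list \<Rightarrow> bool" where
  "consistent c x \<longleftrightarrow> prefix (node c) x \<and> legal R x \<and> mode x = 0 \<and> tape\<^sub>2 x = [] \<and>
    tape\<^sub>0 x = tape\<^sub>0 (node c) \<and>
    (\<forall>F p. x = F \<restriction> length x \<longrightarrow> Phi (guess (node c)) (baire_join F h) = Some p \<longrightarrow>
      tape\<^sub>1 x = p \<restriction> length (tape\<^sub>1 x))"

text \<open>A finite certificate of failure. In the second alternative the guess is wrong at every
  point through \<open>y\<close>, so a correct learner must still abandon it along those that belong
  to Q.\<close>

definition refuted :: "nat \<Rightarrow> nat list \<Rightarrow> bool" where
  "refuted c y \<longleftrightarrow> prefix (node c) y \<and> legal R y \<and> mode y = 0 \<and> tape\<^sub>0 y = tape\<^sub>0 (node c) \<and>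
    (guess y \<noteq> guess (node c) \<or>
     (\<forall>F p. y = F \<restriction> length y \<longrightarrow> Phi (guess (node c)) (baire_join F h) = Some p \<longrightarrow> p \<notin> paths R))"

lemma consistent_node: "consistent c (node c)"
  using start_node[of c] by (auto simp: consistent_def start_def)

lemma advance_cases:
  assumes x: "consistent c x"
  obtains (stay) "advance (h \<restriction> s) (c, x) = (c, x)"
  | (extend) y v where "advance (h \<restriction> s) (c, x) = (c, y)" "consistent c y"
      "prefix x y" "tape\<^sub>1 y = tape\<^sub>1 x @ [v]"
  | (reject) y where "advance (h \<restriction> s) (c, x) = (Suc c, node (Suc c))" "refuted c y"
proof -
  define y where "y = x @ list_decode (fst (prod_decode s))"
  define e where "e = guess (node c)"
  define k where "k = length (tape\<^sub>1 x)"
  define u where "u = eval_bounded s (merge y (h \<restriction> s)) e k"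
  note x = x[unfolded consistent_def, folded e_def k_def]
  have xy: "prefix x y" by (simp add: y_def)
  show ?thesis
  proof (cases "length y \<le> s \<and> legal R y \<and> mode y = 0 \<and> tape\<^sub>0 y = tape\<^sub>0 x")
    case False
    then have "advance (h \<restriction> s) (c, x) = (c, x)"
      unfolding advance_def Let_def fst_conv snd_conv length_initial_segment y_def[symmetric]
      by (simp only: if_False)
    then show ?thesis by (rule stay)
  next
    case True
    then have y: "length y \<le> s" "legal R y" "mode y = 0" "tape\<^sub>0 y = tape\<^sub>0 x" by blast+
    \<comment> \<open>The candidate is a prefix of \<open>y\<close>, so the bound on
      \<open>y\<close> ensures that its guess too is computed from genuine values of
      \<open>h\<close>.\<close>
    have "length (node c) \<le> s"
      using x xy y(1) by (meson le_trans prefix_length_le)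
    then have e: "\<Psi> (merge (node c) (h \<restriction> s)) = e" by (simp add: \<Psi>_merge e_def)
    have adv: "advance (h \<restriction> s) (c, x) =
      (if guess y = e then
         if tape\<^sub>1 y = tape\<^sub>1 x \<and> u \<noteq> 0 then
           if u \<le> 2 \<and> R (tape\<^sub>1 x @ [u - 1]) then (c, y @ [1, 0, u - 1])
           else (Suc c, node (Suc c))
         else (c, x)
       else (Suc c, node (Suc c)))"
      unfolding advance_def Let_def fst_conv snd_conv length_initial_segment y_def[symmetric]
        e \<Psi>_merge[OF y(1)] k_def[symmetric] u_def[symmetric]
      using True by simp
    have ref: "refuted c y"
      if "guess y \<noteq> e \<or> (\<forall>F p. y = F \<restriction> length y \<longrightarrow>
        Phi e (baire_join F h) = Some p \<longrightarrow> p \<notin> paths R)"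
      using that x xy y unfolding refuted_def e_def by auto
    show ?thesis
    proof (cases "guess y = e")
      case False
      then have "refuted c y" by (intro ref disjI1)
      moreover have "advance (h \<restriction> s) (c, x) = (Suc c, node (Suc c))"
        unfolding adv if_not_P[OF False] ..
      ultimately show ?thesis by (intro reject)
    next
      case g: True
      show ?thesis
      proof (cases "tape\<^sub>1 y = tape\<^sub>1 x \<and> u \<noteq> 0")
        case False
        have "advance (h \<restriction> s) (c, x) = (c, x)"
          unfolding adv if_P[OF g] if_not_P[OF False] ..
        then show ?thesis by (rule stay)
      next
        case u: True
        \<comment> \<open>The value was found from \<open>y\<close> and \<open>h\<close> alone, so
          it is right for every point \<open>F\<close> through \<open>y\<close>.\<close>
        have p: "tape\<^sub>1 x = p \<restriction> k" "u = Suc (p k)"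
          if F: "y = F \<restriction> length y" "Phi e (baire_join F h) = Some p" for F p
        proof -
          have "x = F \<restriction> length x" using F(1) xy by (metis prefix_initial_segmentD)
          then show "tape\<^sub>1 x = p \<restriction> k" using x F(2) by (simp add: k_def)
          have "merge y (h \<restriction> s) = baire_join F h \<restriction> (2 * length y)"
            by (rule merge_initial_segment[OF F(1) y(1)])
          then show "u = Suc (p k)"
            using eval_bounded_unique[of e "baire_join F h" k "p k" s "2 * length y"] F(2) u
            by (simp add: u_def Phi_eq_Some_iff)
        qed
        show ?thesis
        proof (cases "u \<le> 2 \<and> R (tape\<^sub>1 x @ [u - 1])")
          case False
          \<comment> \<open>As tape 1 already agrees with \<open>p\<close>, a next value that is no
            bit or leaves the tree shows that \<open>p\<close> is not a path.\<close>
          have "p \<notin> paths R" if "y = F \<restriction> length y" "Phi e (baire_join F h) = Some p" for F p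
          proof
            assume "p \<in> paths R"
            then have "tree R (p \<restriction> Suc k)" by (simp add: mem_paths_iff)
            then show False
              using p[OF that] False by (auto simp: initial_segment_Suc tree_snoc)
          qed
          then have "refuted c y" by (intro ref disjI2) blast
          moreover have "advance (h \<restriction> s) (c, x) = (Suc c, node (Suc c))"
            unfolding adv if_P[OF g] if_P[OF u] if_not_P[OF False] ..
          ultimately show ?thesis by (intro reject)
        next
          case v: True
          let ?y = "y @ [1, 0, u - 1]"
          have v': "u - 1 \<le> 1" using conjunct1[OF v] by linarith
          have ty: "tapes ?y = (0, tape\<^sub>0 y, tape\<^sub>1 y @ [u - 1], [])"
            by (rule write\<^sub>1(1)[OF y(2,3) R_Nil v'])
          have "legal R ?y"
            by (rule write\<^sub>1(2)[OF y(2,3) R_Nil v']) (use u v in simp)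
          moreover have "tape\<^sub>1 ?y = p \<restriction> length (tape\<^sub>1 ?y)"
            if F: "?y = F \<restriction> length ?y" "Phi e (baire_join F h) = Some p" for F p
          proof -
            have "y = F \<restriction> length y" using F(1) by (metis prefix_initial_segmentD prefixI)
            from p[OF this F(2)] show ?thesis
              using ty u by (simp add: tape_defs k_def initial_segment_Suc)
          qed
          ultimately have "consistent c ?y"
            using x xy y ty unfolding consistent_def e_def[symmetric]
            by (auto simp: tape_defs prefix_def)
          moreover have "tape\<^sub>1 ?y = tape\<^sub>1 x @ [u - 1]" using ty u by (simp add: tape_defs)
          moreover have "prefix x ?y" using xy by (auto simp: prefix_def)
          moreover have "advance (h \<restriction> s) (c, x) = (c, ?y)"
            unfolding adv if_P[OF g] if_P[OF u] if_P[OF v] ..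
          ultimately show ?thesis by (intro extend)
        qed
      qed
    qed
  qed
qed

abbreviation "cand s \<equiv> fst (state (h \<restriction> s))"
abbreviation "cur s \<equiv> snd (state (h \<restriction> s))"

lemma state_Suc: "state (h \<restriction> Suc s) = advance (h \<restriction> s) (cand s, cur s)"
  by (simp add: initial_segment_Suc state_snoc)

lemma consistent_state: "consistent (cand s) (cur s)"
proof (induction s)
  case 0
  then show ?case by (simp add: state_Nil consistent_node)
next
  case (Suc s)
  show ?case
    by (rule advance_cases[OF Suc, of s]) (simp_all add: state_Suc consistent_node Suc)
qed

lemma state_cases:
  obtains (stay) "cand (Suc s) = cand s" "cur (Suc s) = cur s"
  | (extend) v where "cand (Suc s) = cand s" "prefix (cur s) (cur (Suc s))"
      "tape\<^sub>1 (cur (Suc s)) = tape\<^sub>1 (cur s) @ [v]"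
  | (reject) y where "cand (Suc s) = Suc (cand s)" "refuted (cand s) y"
  by (rule advance_cases[OF consistent_state, of s s]) (auto simp: state_Suc)

section \<open>Growth of tape 1 under the last candidate\<close>

lemma cand_mono: "s \<le> t \<Longrightarrow> cand s \<le> cand t"
proof (rule lift_Suc_mono_le[of cand])
  show "cand n \<le> cand (Suc n)" for n by (cases n rule: state_cases) simp_all
qed

lemma tape\<^sub>1_mono:
  assumes "s \<le> t" "cand s = cand t"
  shows "prefix (tape\<^sub>1 (cur s)) (tape\<^sub>1 (cur t))"
  using assms
proof (induction t rule: dec_induct)
  case (step t)
  have "cand s = cand t"
    using cand_mono[of s t] cand_mono[of t "Suc t"] step.hyps step.prems by simp
  with step.IH have IH: "prefix (tape\<^sub>1 (cur s)) (tape\<^sub>1 (cur t))" by simp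
  show ?case
    by (cases t rule: state_cases) (use IH step.prems \<open>cand s = cand t\<close> in auto)
qed simp

text \<open>If tape 1 stopped growing, the state would freeze at some \<open>x\<close>. Waiting from
  \<open>x\<close> along \<theta> gives a point of Q, where the learner converges. Its limit is the
  guess of the candidate, as otherwise the candidate would be rejected; so the next value is
  computed there, and testing a long enough piece of this point changes the state.\<close>

lemma final_candidate_extends:
  assumes final: "\<And>s. s \<ge> N \<Longrightarrow> cand s = cand N"
  shows "\<exists>s\<ge>N. L \<le> length (tape\<^sub>1 (cur s))"
proof (induction L)
  case (Suc L)
  then obtain t where t: "t \<ge> N" "L \<le> length (tape\<^sub>1 (cur t))" by blast
  show ?case
  proof (rule ccontr)
    assume "\<not> ?case"
    then have short: "length (tape\<^sub>1 (cur s)) \<le> L" if "s \<ge> N" for s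
      using that not_less_eq_eq by blast
    define c where "c = cand N"
    have c: "cand s = c" if "s \<ge> t" for s using final[of s] that t(1) by (simp add: c_def)
    have stuck: "cur s = cur t" if "s \<ge> t" for s
      using that
    proof (induction s rule: dec_induct)
      case (step s)
      show ?case
      proof (cases s rule: state_cases)
        case (extend v)
        then have "length (tape\<^sub>1 (cur (Suc s))) = Suc (length (tape\<^sub>1 (cur t)))"
          using step.IH by simp
        then show ?thesis using short[of "Suc s"] step.hyps t by simp
      next
        case reject
        then show ?thesis using c[of s] c[of "Suc s"] step.hyps by simp
      qed (use step.IH in simp)
    qed simp
    define x where "x = cur t"
    have x: "legal R x" "mode x = 0" "tape\<^sub>2 x = []" "consistent c x"
      using consistent_state[of t] c[of t] by (auto simp: x_def consistent_def)
    define F where "F = wait x \<theta>"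
    note wp = wait_properties[OF x(1,2) R_Nil x(3) \<theta>, folded F_def]
    have "F \<in> paths (admissible R)" unfolding F_def by (rule wait_mem_paths[OF x(1,2) R_Nil x(3) \<theta>])
    from learns[OF this] obtain e p M where e: "\<And>n. n \<ge> M \<Longrightarrow> \<Psi> (baire_join F h \<restriction> n) = e"
      "Phi e (baire_join F h) = Some p" by blast
    define y where "y m = F \<restriction> (length x + 2 * m)" for m
    define k where "k = length (tape\<^sub>1 x)"
    have y: "legal R (y m)" "mode (y m) = 0" "tape\<^sub>0 (y m) = tape\<^sub>0 x" "tape\<^sub>1 (y m) = tape\<^sub>1 x"
      "length (y m) = length x + 2 * m" for m
      using wp[of m] by (simp_all add: y_def tape_defs)
    have xy: "\<exists>r. y m = x @ r" for m
      using prefix_initial_segment[of "length x" "length x + 2 * m" F] wait_prefix[of x \<theta>]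
      by (simp add: y_def F_def prefix_def)
    have guess_y: "guess (y m) = \<Psi> (baire_join F h \<restriction> (2 * length (y m)))" for m
      by (rule guess_eq) (simp add: y_def)
    have test: "\<exists>s\<ge>K. s \<ge> t \<and> length (y m) \<le> s \<and> y m = x @ list_decode (fst (prod_decode s))" for m K
    proof -
      from xy obtain r where r: "y m = x @ r" by blast
      \<comment> \<open>The second component only delays the stage; the first keeps \<open>r\<close>
        as the extension to be tested.\<close>
      let ?s = "prod_encode (list_encode r, K + t + length (y m))"
      have "K + t + length (y m) \<le> ?s" by (rule le_prod_encode_2)
      then show ?thesis using r by (intro exI[of _ ?s]) auto
    qed
    have clen: "length (node c) \<le> length (y m)" for m
      using x(4) y(5)[of m] prefix_length_le[of "node c" x] by (simp add: consistent_def)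
    have adv: "advance (h \<restriction> s) (c, x) =
      (let u = eval_bounded s (merge (y m) (h \<restriction> s)) (guess (node c)) k in
       if guess (y m) = guess (node c) then
         if u \<noteq> 0 then
           if u \<le> 2 \<and> R (tape\<^sub>1 x @ [u - 1]) then (c, y m @ [1, 0, u - 1])
           else (Suc c, node (Suc c))
         else (c, x)
       else (Suc c, node (Suc c)))"
      if s: "length (y m) \<le> s" "y m = x @ list_decode (fst (prod_decode s))" for s m
      unfolding advance_def Let_def fst_conv snd_conv length_initial_segment s(2)[symmetric]
        \<Psi>_merge[OF s(1)] \<Psi>_merge[OF le_trans[OF clen s(1)]] k_def[symmetric]
      using y[of m] s(1) by simp
    have unchanged: "advance (h \<restriction> s) (c, x) = (c, x)" if "s \<ge> t" for s
      using state_Suc[of s] c[of s] c[of "Suc s"] stuck[of s] stuck[of "Suc s"] that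
      by (metis le_SucI prod.collapse x_def)
    have same: "guess (y m) = guess (node c)" for m
    proof (rule ccontr)
      assume ne: "guess (y m) \<noteq> guess (node c)"
      from test[of 0 m] obtain s where "s \<ge> t" "length (y m) \<le> s"
        "y m = x @ list_decode (fst (prod_decode s))" by blast
      then show False using adv[of m s] unchanged[of s] ne by simp
    qed
    have "guess (y M) = e" using e(1)[of "2 * length (y M)"] y(5)[of M] guess_y by simp
    then have ce: "guess (node c) = e" using same by simp
    from eval_bounded_complete[of e "baire_join F h" k] e(2) obtain K
      where K: "\<forall>s\<ge>K. \<forall>m\<ge>K. eval_bounded s (baire_join F h \<restriction> m) e k = Suc (p k)"
      by (auto simp: Phi_eq_Some_iff)
    from test[of K K] obtain s where s: "s \<ge> K" "s \<ge> t" "length (y K) \<le> s"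
      "y K = x @ list_decode (fst (prod_decode s))" by blast
    have "merge (y K) (h \<restriction> s) = baire_join F h \<restriction> (2 * length (y K))"
      by (rule merge_initial_segment) (use s(3) in \<open>simp_all add: y_def\<close>)
    then have "eval_bounded s (merge (y K) (h \<restriction> s)) e k = Suc (p k)"
      using K s(1) y(5)[of K] by simp
    \<comment> \<open>Since \<open>y K\<close> extends \<open>x\<close>, writing a bit would alter
      the current script, while a rejection would alter the candidate.\<close>
    moreover have "y K @ [1, 0, v] \<noteq> x" for v using xy[of K] by auto
    ultimately show False
      using adv[OF s(3,4)] unchanged[OF s(2)] same[of K] ce by (auto simp: Let_def split: if_splits)
  qed
qed blast

text \<open>One round of the diagonalisation: a longer start, with a change of the guess on the way.
  If \<open>y\<close> shows no change, the change is found further along a point of Q through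
  \<open>y\<close>, where the old guess is wrong.\<close>

lemma refuted_extends:
  assumes x: "start x" "tape\<^sub>0 x = \<theta> \<restriction> j" and c: "c = list_encode x" and ref: "refuted c y"
  shows "\<exists>x' y'. start x' \<and> (\<exists>j. tape\<^sub>0 x' = \<theta> \<restriction> j) \<and> prefix x y' \<and> prefix y' x' \<and> x' \<noteq> y' \<and>
    guess y' \<noteq> guess x"
proof -
  have node: "node c = x" using x c by (simp add: node_def)
  have \<theta>': "R (\<theta> \<restriction> Suc i)" "\<theta> i \<le> 1" for i
    using \<theta>[unfolded mem_paths_iff, rule_format, of "Suc i"] tree_snoc[of R "\<theta> \<restriction> i" "\<theta> i"]
    by (simp_all add: initial_segment_Suc)
  have reset: "start (z @ [1, 1, \<theta> i]) \<and> tape\<^sub>0 (z @ [1, 1, \<theta> i]) = \<theta> \<restriction> Suc i"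
    if z: "legal R z" "mode z = 0" "tape\<^sub>0 z = \<theta> \<restriction> i" for z i
  proof -
    have "tapes (z @ [1, 1, \<theta> i]) = (0, tape\<^sub>0 z @ [\<theta> i], [], [])"
      by (rule write\<^sub>0(1)[OF z(1,2) R_Nil \<theta>'(2)])
    moreover have "legal R (z @ [1, 1, \<theta> i])"
      by (rule write\<^sub>0(2)[OF z(1,2) R_Nil \<theta>'(2)]) (use \<theta>'(1)[of i] z(3) in \<open>simp add: initial_segment_Suc\<close>)
    ultimately show ?thesis using z(3) by (simp add: start_def tape_defs initial_segment_Suc)
  qed
  have y: "prefix x y" "legal R y" "mode y = 0" "tape\<^sub>0 y = \<theta> \<restriction> j"
    using ref x by (auto simp: refuted_def node)
  show ?thesis
  proof (cases "guess y = guess x")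
    case False
    then show ?thesis
      using reset[OF y(2-4)] y(1) by (intro exI[of _ "y @ [1, 1, \<theta> j]"] exI[of _ y]) auto
  next
    case True
    \<comment> \<open>Tape 2 of \<open>y\<close> may hold anything, but waiting along \<theta> needs
      it empty; a write on tape 0 clears it.\<close>
    define w where "w = y @ [1, 1, \<theta> j]"
    have w: "start w" "tape\<^sub>0 w = \<theta> \<restriction> Suc j" unfolding w_def using reset[OF y(2-4)] by blast+
    then have w': "legal R w" "mode w = 0" "tape\<^sub>2 w = []" by (auto simp: start_def)
    define F where "F = wait w \<theta>"
    note wp = wait_properties[OF w'(1,2) R_Nil w'(3) \<theta>, folded F_def]
    have "F \<in> paths (admissible R)" unfolding F_def by (rule wait_mem_paths[OF w'(1,2) R_Nil w'(3) \<theta>])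
    from learns[OF this] obtain e p M where e: "\<And>n. n \<ge> M \<Longrightarrow> \<Psi> (baire_join F h \<restriction> n) = e"
      "Phi e (baire_join F h) = Some p" "p \<in> paths R" by blast
    define z where "z = F \<restriction> (length w + 2 * M)"
    have z: "legal R z" "mode z = 0" "tape\<^sub>0 z = \<theta> \<restriction> Suc j"
      using wp[of M] w(2) by (simp_all add: z_def tape_defs)
    have "prefix w z"
      using prefix_initial_segment[of "length w" "length w + 2 * M" F] wait_prefix[of w \<theta>]
      by (simp add: z_def F_def)
    then have yz: "prefix y z" by (auto simp: w_def prefix_def)
    then have "y = F \<restriction> length y" unfolding z_def by (rule prefix_initial_segmentD)
    then have "guess x \<noteq> e"
      using ref True e(2,3) by (auto simp: refuted_def node)
    moreover have "guess z = e"
      using guess_eq[of z F] e(1)[of "2 * length z"] by (simp add: z_def)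
    ultimately show ?thesis
      using reset[OF z] y(1) yz
      by (intro exI[of _ "z @ [1, 1, \<theta> (Suc j)]"] exI[of _ z]) (auto intro: prefix_order.trans)
  qed
qed

lemma candidate_stabilizes: "\<exists>N. \<forall>s\<ge>N. cand s = cand N"
proof (rule ccontr)
  assume "\<not> ?thesis"
  then have change: "\<exists>s\<ge>N. cand s \<noteq> cand N" for N by blast
  have leave: "\<exists>t\<ge>s. cand t = cand s \<and> cand (Suc t) \<noteq> cand s" for s
  proof (rule ccontr)
    assume never: "\<not> ?thesis"
    have "cand t = cand s" if "t \<ge> s" for t
      using that by (induction t rule: dec_induct) (use never in auto)
    then show False using change by blast
  qed
  \<comment> \<open>The candidate moves in steps of one, so none is skipped.\<close>
  have reach: "\<exists>s. cand s = k" for k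
  proof (induction k)
    case 0
    show ?case by (rule exI[of _ 0]) (simp add: state_Nil)
  next
    case (Suc k)
    then obtain s where "cand s = k" by blast
    with leave[of s] obtain t where "cand t = k" "cand (Suc t) \<noteq> k" by blast
    then show ?case by (cases t rule: state_cases) (auto intro!: exI[of _ "Suc t"])
  qed
  have all_refuted: "\<exists>y. refuted k y" for k
  proof -
    from reach obtain s where "cand s = k" by blast
    with leave[of s] obtain t where "cand t = k" "cand (Suc t) \<noteq> k" by blast
    then show ?thesis by (cases t rule: state_cases) auto
  qed
  let ?S = "\<lambda>x. start x \<and> (\<exists>j. tape\<^sub>0 x = \<theta> \<restriction> j)"
  have "\<exists>X. \<forall>n. ?S (X n) \<and> (\<exists>y. prefix (X n) y \<and> prefix y (X (Suc n)) \<and> X (Suc n) \<noteq> y \<and>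
      guess y \<noteq> guess (X n))"
  proof (rule dependent_nat_choice)
    show "\<exists>x. ?S x" using start_Nil by (intro exI[of _ "[]"]) (auto intro!: exI[of _ 0])
    \<comment> \<open>Every start is a candidate through its own code \<open>list_encode x\<close>,
      so a refutation is available wherever the chain has arrived.\<close>
    show "\<exists>x'. ?S x' \<and> (\<exists>y. prefix x y \<and> prefix y x' \<and> x' \<noteq> y \<and> guess y \<noteq> guess x)"
      if "?S x" for x n
      using that all_refuted refuted_extends by metis
  qed
  then obtain X where X: "\<And>n. ?S (X n)"
    "\<And>n. \<exists>y. prefix (X n) y \<and> prefix y (X (Suc n)) \<and> X (Suc n) \<noteq> y \<and> guess y \<noteq> guess (X n)"
    by blast
  have chain: "prefix (X n) (X (Suc n))" for n using X(2)[of n] prefix_order.trans by blast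
  have "length (X n) < length (X (Suc n))" for n
  proof (rule prefix_length_less)
    have "X n \<noteq> X (Suc n)" using X(2)[of n] prefix_order.antisym by metis
    then show "strict_prefix (X n) (X (Suc n))" using chain by (simp add: strict_prefix_def)
  qed
  then have len: "n \<le> length (X n)" for n
    by (induction n) (auto simp: Suc_le_eq intro: le_less_trans)
  from prefix_chain_limit[of X, OF chain] len obtain F where F: "\<And>n. X n = F \<restriction> length (X n)"
    by blast
  have "\<exists>n\<ge>L. legal R (F \<restriction> n)" for L
    using X(1)[of L] F[of L] len[of L] unfolding start_def by metis
  then have "F \<in> paths (admissible R)" by (rule mem_pathsI)
  from learns[OF this] obtain e M where e: "\<And>n. n \<ge> M \<Longrightarrow> \<Psi> (baire_join F h \<restriction> n) = e"
    by blast
  from X(2)[of M] obtain y where y: "prefix (X M) y" "prefix y (X (Suc M))" "guess y \<noteq> guess (X M)"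
    by blast
  have "y = F \<restriction> length y" using y(2) F[of "Suc M"] by (metis prefix_initial_segmentD)
  then have "guess y = e"
    using guess_eq[of y F] e[of "2 * length y"] prefix_length_le[OF y(1)] len[of M] by simp
  moreover have "guess (X M) = e"
    using guess_eq[OF F, of M] e[of "2 * length (X M)"] len[of M] by simp
  ultimately show False using y(3) by simp
qed

lemma emit_limit:
  obtains c p where "\<exists>N. \<forall>s\<ge>N. cand s = c" "p \<in> paths R"
    "\<And>k. \<exists>s. emit (h \<restriction> s, c, k) \<noteq> 0"
    "\<And>k s. emit (h \<restriction> s, c, k) \<noteq> 0 \<Longrightarrow> emit (h \<restriction> s, c, k) = Suc (p k)"
proof -
  from candidate_stabilizes obtain N where N: "\<And>s. s \<ge> N \<Longrightarrow> cand s = cand N" by blast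
  define X where "X n = tape\<^sub>1 (cur (N + n))" for n
  have chain: "prefix (X n) (X (Suc n))" for n
    unfolding X_def by (rule tape\<^sub>1_mono) (use N[of "N + n"] N[of "N + Suc n"] in simp_all)
  have unb: "\<exists>n. L \<le> length (X n)" for L
    using final_candidate_extends[of N L] N unfolding X_def by (metis le_Suc_ex)
  from prefix_chain_limit[of X, OF chain unb] obtain p where p: "\<And>n. X n = p \<restriction> length (X n)"
    by blast
  \<comment> \<open>Membership in P comes from the legality of the scripts; whether the guess was
    right does not enter.\<close>
  have legal: "tree R (X n)" for n
    using consistent_state[of "N + n"] legal_tapes(2) by (auto simp: consistent_def X_def)
  have "\<exists>n\<ge>L. tree R (p \<restriction> n)" for L using unb[of L] legal p by metis
  then have "p \<in> paths R" by (rule mem_pathsI)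
  moreover have "\<exists>s. emit (h \<restriction> s, cand N, k) \<noteq> 0" for k
  proof -
    from unb[of "Suc k"] obtain n where "k < length (X n)" by (auto simp: Suc_le_eq)
    then have "emit (h \<restriction> (N + n), cand N, k) \<noteq> 0"
      using N[of "N + n"] by (simp add: emit_def X_def)
    then show ?thesis by blast
  qed
  moreover have "emit (h \<restriction> s, cand N, k) = Suc (p k)" if "emit (h \<restriction> s, cand N, k) \<noteq> 0" for s k
  proof -
    from that have s: "cand s = cand N" "k < length (tape\<^sub>1 (cur s))"
      by (auto simp: emit_def split: if_splits)
    \<comment> \<open>Stage \<open>s\<close> may precede \<open>N\<close>. It is compared with stage
      \<open>N + s\<close>, which has the same candidate.\<close>
    have "prefix (tape\<^sub>1 (cur s)) (tape\<^sub>1 (cur (N + s)))"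
      by (rule tape\<^sub>1_mono) (use s(1) N[of "N + s"] in simp_all)
    then have "tape\<^sub>1 (cur s) = p \<restriction> length (tape\<^sub>1 (cur s))"
      using p[of s] unfolding X_def by (metis prefix_initial_segmentD)
    then have "get (tape\<^sub>1 (cur s)) k = p k" using s(2) by (metis get_initial_segment)
    then show ?thesis using s by (simp add: emit_def)
  qed
  ultimately show ?thesis using that N by blast
qed

end

section \<open>Passage to sets and degrees\<close>

lemma anticupping_paths:
  assumes R: "effective R" and ne: "\<theta> \<in> paths R"
    and le: "learn_le (paths R) (set_join (paths (admissible R)) C)"
  shows "learn_le (paths R) C"
proof -
  have "R (\<theta> \<restriction> 0)" using ne unfolding paths_def by blast
  then have R_Nil: "R []" by simp
  obtain \<Psi> where \<Psi>: "effective \<Psi>" "\<And>g. g \<in> set_join (paths (admissible R)) C \<Longrightarrow>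
      \<exists>e p. (\<exists>N. \<forall>n\<ge>N. \<Psi> (g \<restriction> n) = e) \<and> Phi e g = Some p \<and> p \<in> paths R"
    using learn_leE[OF le] by blast
  interpret anticupping R \<Psi> by unfold_locales (use R R_Nil \<Psi> in auto)
  from learn_index[OF effective_emit] obtain ix where ix: "effective ix"
    "\<And>c h p. (\<And>k. \<exists>s. emit (h \<restriction> s, c, k) \<noteq> 0) \<Longrightarrow>
      (\<And>k s. emit (h \<restriction> s, c, k) \<noteq> 0 \<Longrightarrow> emit (h \<restriction> s, c, k) = Suc (p k)) \<Longrightarrow>
      Phi (ix c) h = Some p"
    by metis
  have "effective (\<lambda>z. ix (fst (state z)))"
    by (intro eff effective_comp[OF ix(1)] effective_comp[OF effective_state])
  moreover have "\<exists>e p. (\<exists>N. \<forall>n\<ge>N. ix (fst (state (h \<restriction> n))) = e) \<and> Phi e h = Some p \<and> p \<in> paths R"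
    if h: "h \<in> C" for h
  proof -
    interpret anticupping_oracle R \<Psi> h \<theta>
    proof unfold_locales
      fix f assume "f \<in> paths (admissible R)"
      then have "baire_join f h \<in> set_join (paths (admissible R)) C"
        using h by (auto simp: set_join_def)
      then show "\<exists>e p. (\<exists>N. \<forall>n\<ge>N. \<Psi> (baire_join f h \<restriction> n) = e) \<and>
          Phi e (baire_join f h) = Some p \<and> p \<in> paths R"
        by (rule \<Psi>(2))
    qed (rule ne)
    obtain c p where "\<exists>N. \<forall>s\<ge>N. fst (state (h \<restriction> s)) = c" "p \<in> paths R"
      "\<And>k. \<exists>s. emit (h \<restriction> s, c, k) \<noteq> 0"
      "\<And>k s. emit (h \<restriction> s, c, k) \<noteq> 0 \<Longrightarrow> emit (h \<restriction> s, c, k) = Suc (p k)"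
      using emit_limit by blast
    then show ?thesis using ix(2)[of h c p] by metis
  qed
  ultimately show ?thesis unfolding learn_le_iff by blast
qed

theorem corollary57:
  fixes a :: degree
  assumes "a \<in> P1w" and "a \<noteq> zero_degree"
  shows "strong_anticupping a"
proof -
  from assms(1) obtain R where R: "effective R" and a: "a = deg (paths R)" and ne: "paths R \<noteq> {}"
    unfolding P1w_def Pi01_iff_paths by blast
  from ne obtain \<theta> where \<theta>: "\<theta> \<in> paths R" by blast
  have special: "paths R \<notin> zero_degree" using assms(2) a deg_eq_zero_degree by blast
  show ?thesis
    unfolding a
  proof (rule strong_anticuppingI[where Q = "paths (admissible R)"])
    show "Pi01 (paths (admissible R))"
      unfolding Pi01_iff_paths using effective_admissible[OF R] by blast
    \<comment> \<open>A nonempty class has the empty string in its tree, which makes the empty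
      script legal and waiting from it possible.\<close>
    have "R (\<theta> \<restriction> 0)" using \<theta> unfolding paths_def by blast
    then have "R []" by simp
    then have "wait [] \<theta> \<in> paths (admissible R)"
      by (intro wait_mem_paths \<theta>) (simp_all add: admissible_def)
    then show "paths (admissible R) \<noteq> {}" by blast
    show "paths (admissible R) \<notin> zero_degree"
      using special computable_path_of_tapes unfolding zero_degree_def by blast
    show "learn_le (paths R) C" if "learn_le (paths R) (set_join (paths (admissible R)) C)" for C
      using anticupping_paths[OF R \<theta> that] .
  qed
qed

end
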